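(* Let $n\ge 1$ and $0\le d\le \lfloor (n-1)/2\rfloor$. The number of ballot permutations of length $n$ with exactly $d$ descents equals the number of odd order permutations $\pi$ of length $n$ with $M(\pi)=d$.
   Context: For a permutation $\pi=\pi_1\pi_2\cdots\pi_n$ of $[n]=\{1,\dots,n\}$, a position $1\le i\le n-1$ is a descent if $\pi_i>\pi_{i+1}$ and an ascent if $\pi_i<\pi_{i+1}$; $\operatorname{des}(\pi)$ and $\operatorname{asc}(\pi)$ denote their numbers. A ballot permutation is a permutation $\pi$ such that $\operatorname{asc}(\pi_1\cdots\pi_i)\ge \operatorname{des}(\pi_1\cdots\pi_i)$ for every $i\in[n]$. An odd order permutation of $[n]$ is one all of whose cycles (in its disjoint cycle decomposition) have odd length. For a cycle $c=(c_1c_2\cdots c_k)$, let $\operatorname{cdes}(c)=|\{i\in[k]: c_i>c_{i+1}\}|$ and $\operatorname{casc}(c)=|\{i\in[k]: c_i<c_{i+1}\}|$, where $c_{k+1}=c_1$. For a permutation $\pi$, $M(\pi)=\sum_c \min(\operatorname{cdes}(c),\operatorname{casc}(c))$, the sum over all cycles $c$ of $\pi$. *)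

theory Defs
  imports "HOL-Combinatorics.Permutations"
begin

text \<open>Permutations of [n] = {1..n} are functions p with p permutes {1..n};
the one-line notation is p 1, p 2, ..., p n.\<close>

definition des_prefix :: "(nat \<Rightarrow> nat) \<Rightarrow> nat \<Rightarrow> nat" where
  "des_prefix p i = card {j. 1 \<le> j \<and> j < i \<and> p j > p (Suc j)}"

definition asc_prefix :: "(nat \<Rightarrow> nat) \<Rightarrow> nat \<Rightarrow> nat" where
  "asc_prefix p i = card {j. 1 \<le> j \<and> j < i \<and> p j < p (Suc j)}"

definition des :: "nat \<Rightarrow> (nat \<Rightarrow> nat) \<Rightarrow> nat" where
  "des n p = des_prefix p n"

definition ballot :: "nat \<Rightarrow> (nat \<Rightarrow> nat) \<Rightarrow> bool" where
  "ballot n p \<longleftrightarrow> (\<forall>i\<in>{1..n}. asc_prefix p i \<ge> des_prefix p i)"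

definition cyc :: "(nat \<Rightarrow> nat) \<Rightarrow> nat \<Rightarrow> nat set" where
  "cyc p x = {(p ^^ k) x | k. True}"

definition cycles :: "nat \<Rightarrow> (nat \<Rightarrow> nat) \<Rightarrow> nat set set" where
  "cycles n p = cyc p ` {1..n}"

definition odd_order :: "nat \<Rightarrow> (nat \<Rightarrow> nat) \<Rightarrow> bool" where
  "odd_order n p \<longleftrightarrow> (\<forall>c\<in>cycles n p. odd (card c))"

text \<open>For a cycle c = (c_1 ... c_k) of p we have p c_i = c_(i+1) (indices mod k), so
  cdes(c) counts the elements y of c with y > p y, casc(c) those with y < p y.\<close>
definition cdes :: "(nat \<Rightarrow> nat) \<Rightarrow> nat set \<Rightarrow> nat" where
  "cdes p c = card {y\<in>c. y > p y}"

definition casc :: "(nat \<Rightarrow> nat) \<Rightarrow> nat set \<Rightarrow> nat" where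
  "casc p c = card {y\<in>c. y < p y}"

definition M :: "nat \<Rightarrow> (nat \<Rightarrow> nat) \<Rightarrow> nat" where
  "M n p = (\<Sum>c\<in>cycles n p. min (cdes p c) (casc p c))"

end

theory Submission
  imports
    Defs
    "HOL-Library.Infinite_Set"
    "HOL-Combinatorics.Multiset_Permutations"
    "HOL-Combinatorics.Cycles"
    "HOL-Computational_Algebra.Formal_Power_Series"
    "HOL-Computational_Algebra.Polynomial"
begin

text \<open>
  View a permutation as a path with a step up for each ascent and a step down for each descent.
  Cutting a path at its last (or first) minimum leaves a reversed ballot permutation on the left and
  a ballot permutation on the right. Hence, if \<open>B(t)\<close> and \<open>R(t)\<close> are the exponential generating
  functions of the polynomials \<open>B\<^sub>n(t)\<close> of ballot permutations by descents and of
  \<open>t^n B\<^sub>n(1/t)\<close>, and \<open>A\<close> is that of the Eulerian polynomials, then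
  \<open>R B = E\<close> with \<open>E = 1 + (1 + t) A\<close>. Splitting permutations at the maximum gives a Riccati
  equation for \<open>A\<close>, from which the logarithmic derivative of \<open>E\<close> is \<open>1 + t\<close> plus \<open>2 t\<close> times the
  even part of \<open>A\<close>. Opening a cycle at its maximum shows that this counts odd
  cycles with weight \<open>t^min + t^max\<close>, the minimum and the maximum being taken over the
  numbers of cyclic descents and ascents. So \<open>E\<close> also factors as \<open>O' O\<close>, where \<open>O\<close> counts odd order
  permutations by \<open>M\<close>. In degree \<open>n > 0\<close> the factors \<open>B\<close> and \<open>O\<close> only have exponents \<open>d < n/2\<close>, the
  factors \<open>R\<close> and \<open>O'\<close> only exponents \<open>d > n/2\<close>, and such a factorization is unique; hence \<open>B = O\<close>.
\<close>

section \<open>Up-down words of permutations\<close>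

fun updown :: "'a::linorder list \<Rightarrow> bool list" where
  "updown (x # y # zs) = (x < y) # updown (y # zs)"
| "updown [x] = []"
| "updown [] = []"

lemma length_updown [simp]: "length (updown xs) = length xs - 1"
  by (induction xs rule: updown.induct) auto

lemma updown_append:
  "xs \<noteq> [] \<Longrightarrow> ys \<noteq> [] \<Longrightarrow> updown (xs @ ys) = updown xs @ (last xs < hd ys) # updown ys"
proof (induction xs rule: updown.induct)
  case (2 x)
  then show ?case by (cases ys) auto
qed auto

lemma updown_nth: "Suc i < length xs \<Longrightarrow> updown xs ! i = (xs ! i < xs ! Suc i)"
proof (induction xs arbitrary: i rule: updown.induct)
  case (1 x y zs)
  then show ?case by (cases i) auto
qed auto

text \<open>Reversal turns every gap around and so exchanges ascents and descents; equal neighbours,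
  which distinctness excludes, would give \<open>False\<close> in both directions.\<close>

lemma updown_rev: "distinct xs \<Longrightarrow> updown (rev xs) = map Not (rev (updown xs))"
proof (induction xs rule: updown.induct)
  case (1 x y zs)
  have "updown (rev (x # y # zs)) = updown (rev (y # zs)) @ [y < x]"
    using updown_append[of "rev (y # zs)" "[x]"] by simp
  with 1 show ?case by auto
qed auto

lemma updown_map: "strict_mono_on S h \<Longrightarrow> set xs \<subseteq> S \<Longrightarrow> updown (map h xs) = updown xs"
  by (induction xs rule: updown.induct) (auto simp: strict_mono_on_less)

text \<open>Concatenation is inverse to cutting a word on \<open>S\<close> at position
  \<open>i\<close>; the subset \<open>T\<close> is recovered as the set of the first
  \<open>i\<close> letters.\<close>

lemma sum_permutations_split:
  fixes f :: "'a list \<Rightarrow> 'a list \<Rightarrow> 'b::comm_monoid_add"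
  assumes "finite S"
  shows "(\<Sum>T\<in>Pow S. \<Sum>xs\<in>permutations_of_set T. \<Sum>ys\<in>permutations_of_set (S - T). f xs ys) =
         (\<Sum>zs\<in>permutations_of_set S. \<Sum>i\<le>card S. f (take i zs) (drop i zs))"
proof -
  have "(\<Sum>T\<in>Pow S. \<Sum>xs\<in>permutations_of_set T. \<Sum>ys\<in>permutations_of_set (S - T). f xs ys) =
     (\<Sum>(T,xs,ys)\<in>(SIGMA T:Pow S. permutations_of_set T \<times> permutations_of_set (S - T)). f xs ys)"
    using assms by (simp add: sum.Sigma sum.cartesian_product)
  also have "\<dots> = (\<Sum>(zs,i)\<in>permutations_of_set S \<times> {..card S}. f (take i zs) (drop i zs))"
  proof (rule sum.reindex_bij_witness[where
          i = "\<lambda>(zs,i). (set (take i zs), take i zs, drop i zs)" and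
          j = "\<lambda>(T,xs,ys). (xs @ ys, length xs)"])
    fix a assume "a \<in> (SIGMA T:Pow S. permutations_of_set T \<times> permutations_of_set (S - T))"
    then obtain T xs ys where a: "a = (T, xs, ys)" and *: "T \<subseteq> S" "set xs = T" "distinct xs"
        "set ys = S - T" "distinct ys"
      by (auto simp: permutations_of_set_def)
    show "(case (case a of (T,xs,ys) \<Rightarrow> (xs @ ys, length xs)) of
        (zs,i) \<Rightarrow> (set (take i zs), take i zs, drop i zs)) = a"
      and "(case (case a of (T,xs,ys) \<Rightarrow> (xs @ ys, length xs)) of
        (zs,i) \<Rightarrow> f (take i zs) (drop i zs)) = (case a of (T,xs,ys) \<Rightarrow> f xs ys)"
      using * by (simp_all add: a)
    have "length xs \<le> card S"
      using * assms by (metis card_mono distinct_card)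
    then show "(case a of (T,xs,ys) \<Rightarrow> (xs @ ys, length xs)) \<in> permutations_of_set S \<times> {..card S}"
      using * by (auto simp: a permutations_of_set_def)
  next
    fix b assume "b \<in> permutations_of_set S \<times> {..card S}"
    then obtain zs i where b: "b = (zs, i)" and *: "set zs = S" "distinct zs" "i \<le> card S"
      by (auto simp: permutations_of_set_def)
    have "length zs = card S" using *(1) distinct_card[OF *(2)] by simp
    then show "(case (case b of (zs,i) \<Rightarrow> (set (take i zs), take i zs, drop i zs)) of
        (T,xs,ys) \<Rightarrow> (xs @ ys, length xs)) = b"
      using * by (simp add: b)
    have "set (drop i zs) = S - set (take i zs)"
      using *(1) set_take_disj_set_drop_if_distinct[OF *(2) order_refl, of i]
        set_append[of "take i zs" "drop i zs"]
      unfolding append_take_drop_id by blast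
    then show "(case b of (zs,i) \<Rightarrow> (set (take i zs), take i zs, drop i zs)) \<in>
        (SIGMA T:Pow S. permutations_of_set T \<times> permutations_of_set (S - T))"
      using * by (auto simp: b permutations_of_set_def dest: in_set_takeD)
  qed
  finally show ?thesis using assms by (simp add: sum.cartesian_product)
qed

text \<open>As \<open>m\<close> occurs exactly once, a word on \<open>insert m S\<close> splits
  around it in a unique way.\<close>

lemma sum_permutations_insert:
  fixes f :: "'a list \<Rightarrow> 'b::comm_monoid_add"
  assumes "finite S" "m \<notin> S"
  shows "(\<Sum>zs\<in>permutations_of_set (insert m S). f zs) =
    (\<Sum>T\<in>Pow S. \<Sum>xs\<in>permutations_of_set T. \<Sum>ys\<in>permutations_of_set (S - T). f (xs @ m # ys))"
proof -
  have "(\<Sum>T\<in>Pow S. \<Sum>xs\<in>permutations_of_set T. \<Sum>ys\<in>permutations_of_set (S - T). f (xs @ m # ys)) =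
     (\<Sum>(T,xs,ys)\<in>(SIGMA T:Pow S. permutations_of_set T \<times> permutations_of_set (S - T)). f (xs @ m # ys))"
    using assms by (simp add: sum.Sigma sum.cartesian_product)
  also have "\<dots> = (\<Sum>a\<in>(SIGMA T:Pow S. permutations_of_set T \<times> permutations_of_set (S - T)).
      f ((\<lambda>(T,xs,ys). xs @ m # ys) a))"
    by (simp add: case_prod_unfold)
  also have "\<dots> = (\<Sum>zs\<in>permutations_of_set (insert m S). f zs)"
  proof (rule sum.reindex_bij_betw)
    show "bij_betw (\<lambda>(T,xs,ys). xs @ m # ys)
      (SIGMA T:Pow S. permutations_of_set T \<times> permutations_of_set (S - T)) (permutations_of_set (insert m S))"
    proof (rule bij_betw_imageI)
      show "inj_on (\<lambda>(T,xs,ys). xs @ m # ys)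
          (SIGMA T:Pow S. permutations_of_set T \<times> permutations_of_set (S - T))"
      proof (rule inj_onI)
        fix a b
        assume a: "a \<in> (SIGMA T:Pow S. permutations_of_set T \<times> permutations_of_set (S - T))"
          and b: "b \<in> (SIGMA T:Pow S. permutations_of_set T \<times> permutations_of_set (S - T))"
          and eq: "(case a of (T,xs,ys) \<Rightarrow> xs @ m # ys) = (case b of (T,xs,ys) \<Rightarrow> xs @ m # ys)"
        obtain xs ys where "a = (set xs, xs, ys)" "m \<notin> set xs" "m \<notin> set ys"
          using a assms(2) by (auto simp: permutations_of_set_def)
        moreover obtain xs' ys' where "b = (set xs', xs', ys')"
          using b by (auto simp: permutations_of_set_def)
        ultimately show "a = b"
          using eq by (simp add: append_Cons_eq_iff)
      qed
      show "(\<lambda>(T,xs,ys). xs @ m # ys) `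
          (SIGMA T:Pow S. permutations_of_set T \<times> permutations_of_set (S - T)) =
          permutations_of_set (insert m S)"
      proof (intro equalityI subsetI)
        fix zs assume zs: "zs \<in> permutations_of_set (insert m S)"
        then obtain xs ys where split: "zs = xs @ m # ys"
          by (metis in_set_conv_decomp insertI1 permutations_of_setD(1))
        then have "xs \<in> permutations_of_set (set xs)" "ys \<in> permutations_of_set (S - set xs)" "set xs \<subseteq> S"
          using zs assms(2) by (auto simp: permutations_of_set_def)
        then show "zs \<in> (\<lambda>(T,xs,ys). xs @ m # ys) `
          (SIGMA T:Pow S. permutations_of_set T \<times> permutations_of_set (S - T))"
          using split by (intro image_eqI[of _ _ "(set xs, xs, ys)"]) auto
      next
        fix zs assume "zs \<in> (\<lambda>(T,xs,ys). xs @ m # ys) `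
          (SIGMA T:Pow S. permutations_of_set T \<times> permutations_of_set (S - T))"
        then obtain T xs ys where zs: "zs = xs @ m # ys" and T: "T \<subseteq> S"
            and "xs \<in> permutations_of_set T" "ys \<in> permutations_of_set (S - T)"
          by auto
        then have xs: "set xs = T" "distinct xs" and ys: "set ys = S - T" "distinct ys"
          by (simp_all add: permutations_of_set_def)
        show "zs \<in> permutations_of_set (insert m S)"
        proof (rule permutations_of_setI)
          show "set zs = insert m S" using T by (auto simp: zs xs ys)
          show "distinct zs" using T assms(2) xs(2) ys(2) by (auto simp: zs xs(1) ys(1))
        qed
      qed
    qed
  qed
  finally show ?thesis by simp
qed

text \<open>The up-down word sees only the relative order of the letters, so these can be relabelled
  along the increasing bijection from \<open>{..<card S}\<close>.\<close>

lemma sum_updown_card: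
  fixes S :: "'a::wellorder set" and f :: "bool list \<Rightarrow> 'b::comm_monoid_add"
  assumes "finite S"
  shows "(\<Sum>xs\<in>permutations_of_set S. f (updown xs)) =
         (\<Sum>xs\<in>permutations_of_set {..<card S}. f (updown xs))"
proof -
  obtain h where h: "bij_betw h {..<card S} S" "strict_mono_on {..<card S} h"
    using ex_bij_betw_strict_mono_card[OF assms] by blast
  then have inj: "inj_on h {..<card S}" and S: "S = h ` {..<card S}" by (auto simp: bij_betw_def)
  have "inj_on (map h) (permutations_of_set {..<card S})"
    using inj_on_mapI[of h "permutations_of_set {..<card S}"] inj
    by (auto simp: permutations_of_set_def intro: inj_on_subset)
  moreover have "permutations_of_set S = map h ` permutations_of_set {..<card S}"
    using permutations_of_set_image_inj[OF inj] S by simp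
  ultimately have "(\<Sum>xs\<in>permutations_of_set S. f (updown xs)) =
      (\<Sum>xs\<in>permutations_of_set {..<card S}. f (updown (map h xs)))"
    by (simp add: sum.reindex)
  also have "\<dots> = (\<Sum>xs\<in>permutations_of_set {..<card S}. f (updown xs))"
    by (intro sum.cong refl) (simp add: updown_map[OF h(2)] permutations_of_set_def)
  finally show ?thesis .
qed

lemma sum_Pow_card:
  fixes f :: "nat \<Rightarrow> 'b::semiring_1"
  assumes "finite S"
  shows "(\<Sum>T\<in>Pow S. f (card T)) = (\<Sum>k\<le>card S. of_nat (card S choose k) * f k)"
proof -
  have "(\<Sum>T\<in>Pow S. f (card T)) = (\<Sum>k\<le>card S. \<Sum>T\<in>{T\<in>Pow S. card T = k}. f (card T))"
    using assms by (intro sum.group[symmetric]) (auto intro: card_mono)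
  also have "\<dots> = (\<Sum>k\<le>card S. of_nat (card S choose k) * f k)"
    by (intro sum.cong refl) (simp add: n_subsets[OF assms])
  finally show ?thesis .
qed

section \<open>Cutting a word at its lowest point\<close>

lemma updown_take: "updown (take (Suc j) xs) = take j (updown xs)"
  by (rule nth_equalityI) (auto simp: updown_nth min_def split: if_splits)

lemma updown_drop: "updown (drop j xs) = drop j (updown xs)"
  by (rule nth_equalityI) (auto simp: updown_nth)

definition ht :: "bool list \<Rightarrow> int" where
  "ht bs = int (count_list bs True) - int (count_list bs False)"

definition ballot_word :: "bool list \<Rightarrow> bool" where
  "ballot_word bs \<longleftrightarrow> (\<forall>i\<le>length bs. 0 \<le> ht (take i bs))"

text \<open>Equivalently, the ballot condition for \<open>map Not (rev bs)\<close>, which by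
  \<open>updown_rev\<close> is the word of the reversed permutation.\<close>

definition rev_ballot_word :: "bool list \<Rightarrow> bool" where
  "rev_ballot_word bs \<longleftrightarrow> (\<forall>i\<le>length bs. ht (drop i bs) \<le> 0)"

lemma ht_simps [simp]:
  "ht [] = 0" "ht (b # bs) = (if b then 1 else -1) + ht bs" "ht (bs @ cs) = ht bs + ht cs"
  by (auto simp: ht_def)

lemma ht_drop: "ht (drop i bs) = ht bs - ht (take i bs)"
  using ht_simps(3)[of "take i bs" "drop i bs"] by simp

lemma ht_take_Suc: "i < length bs \<Longrightarrow> ht (take (Suc i) bs) = ht (take i bs) + (if bs ! i then 1 else -1)"
  by (simp add: take_Suc_conv_app_nth)

text \<open>Heights of factors are differences of heights of prefixes. Here and in
  \<open>ballot_word_drop\<close> the word condition becomes minimality of the height at the cut, on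
  its left and on its right respectively.\<close>

lemma rev_ballot_word_take:
  "i \<le> length bs \<Longrightarrow> rev_ballot_word (take i bs) \<longleftrightarrow> (\<forall>j\<le>i. ht (take i bs) \<le> ht (take j bs))"
  by (simp add: rev_ballot_word_def ht_drop min_def)

lemma ballot_word_drop:
  assumes "i \<le> length bs"
  shows "ballot_word (drop i bs) \<longleftrightarrow> (\<forall>j. i \<le> j \<and> j \<le> length bs \<longrightarrow> ht (take i bs) \<le> ht (take j bs))"
proof -
  have ht: "ht (take k (drop i bs)) = ht (take (i + k) bs) - ht (take i bs)" for k
    by (simp add: take_add)
  show ?thesis
  proof
    assume L: "ballot_word (drop i bs)"
    show "\<forall>j. i \<le> j \<and> j \<le> length bs \<longrightarrow> ht (take i bs) \<le> ht (take j bs)"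
    proof (intro allI impI)
      fix j assume "i \<le> j \<and> j \<le> length bs"
      then show "ht (take i bs) \<le> ht (take j bs)"
        using L[unfolded ballot_word_def, rule_format, of "j - i"] ht[of "j - i"] by auto
    qed
  next
    assume "\<forall>j. i \<le> j \<and> j \<le> length bs \<longrightarrow> ht (take i bs) \<le> ht (take j bs)"
    then show "ballot_word (drop i bs)"
      using assms by (auto simp: ballot_word_def ht)
  qed
qed

text \<open>A cut at an ascent with these two properties is a cut at the last minimum of the height.\<close>
lemma card_cut_at_ascent:
  "card {i. i < length bs \<and> bs ! i \<and> rev_ballot_word (take i bs) \<and> ballot_word (drop (Suc i) bs)} =
   (if rev_ballot_word bs then 0 else 1)" (is "card ?C = _")
proof -
  define h where "h = (\<lambda>i. ht (take i bs))"
  have h: "ht (take i bs) = h i" for i by (simp add: h_def)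
  define N where "N = length bs"
  \<comment> \<open>The cut removes letter \<open>i\<close>, so the right part starts at height
    \<open>h (Suc i)\<close>. Across an ascent this is \<open>h i + 1\<close>, and weak minimality
    of it is strict minimality of \<open>h i\<close> over the integers; conversely, strictness at
    \<open>j = Suc i\<close> forces letter \<open>i\<close> to be an ascent.\<close>
  have C: "i \<in> ?C \<longleftrightarrow> i < N \<and> (\<forall>j\<le>i. h i \<le> h j) \<and> (\<forall>j. i < j \<and> j \<le> N \<longrightarrow> h i < h j)" for i
  proof (cases "i < N")
    case True
    then have hS: "h (Suc i) = h i + (if bs ! i then 1 else -1)"
      by (simp add: h_def N_def ht_take_Suc)
    have "i \<in> ?C \<longleftrightarrow> bs ! i \<and> (\<forall>j\<le>i. h i \<le> h j) \<and> (\<forall>j. i < j \<and> j \<le> N \<longrightarrow> h (Suc i) \<le> h j)"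
      using True by (simp add: N_def rev_ballot_word_take ballot_word_drop h Suc_le_eq)
    also have "\<dots> \<longleftrightarrow> (\<forall>j\<le>i. h i \<le> h j) \<and> (\<forall>j. i < j \<and> j \<le> N \<longrightarrow> h i < h j)"
    proof (cases "bs ! i")
      case True
      moreover have "h i + 1 \<le> h j \<longleftrightarrow> h i < h j" for j by linarith
      ultimately show ?thesis using hS by simp
    next
      case False
      with hS \<open>i < N\<close> show ?thesis by (auto intro!: exI[of _ "Suc i"])
    qed
    finally show ?thesis using True by simp
  qed (auto simp: N_def)
  \<comment> \<open>The exceptional words are those whose endpoint is a minimum: the last minimum is
    then \<open>N\<close>, with no letter after it to remove.\<close>
  have RB: "rev_ballot_word bs \<longleftrightarrow> (\<forall>j\<le>N. h N \<le> h j)"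
    using rev_ballot_word_take[of N bs] by (simp add: N_def h_def)
  show ?thesis
  proof (cases "rev_ballot_word bs")
    case True
    have "i \<notin> ?C" for i
    proof
      assume "i \<in> ?C"
      then have "i < N" "h i < h N" unfolding C by auto
      with RB True show False by (meson less_imp_le not_le)
    qed
    then have "?C = {}" by blast
    with True show ?thesis by simp
  next
    case False
    define K where "K = {i. i \<le> N \<and> (\<forall>j\<le>N. h i \<le> h j)}"
    have "finite K" by (simp add: K_def)
    moreover have "K \<noteq> {}"
      using ex_is_arg_min_if_finite[of "{..N}" h] unfolding K_def is_arg_min_linorder by auto
    ultimately have L: "Max K \<in> K" by simp
    have later: "h (Max K) < h j" if "Max K < j" "j \<le> N" for j
    proof (rule ccontr)
      assume "\<not> h (Max K) < h j"
      then have "j \<in> K" using L that unfolding K_def by force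
      then show False using Max_ge[OF \<open>finite K\<close>] that by force
    qed
    have "Max K \<noteq> N" using False RB L by (auto simp: K_def)
    then have "Max K \<in> ?C" unfolding C using L later by (auto simp: K_def)
    moreover have "i = i'" if "i \<in> ?C" "i' \<in> ?C" for i i'
      using that unfolding C by (metis less_imp_le linorder_neqE_nat not_less)
    ultimately have "?C = {Max K}" by blast
    with False show ?thesis by simp
  qed
qed

text \<open>A cut at a descent with these two properties is a cut just before the first minimum of the height.\<close>
lemma card_cut_at_descent:
  "card {i. i < length bs \<and> \<not> bs ! i \<and> rev_ballot_word (take i bs) \<and> ballot_word (drop (Suc i) bs)} =
   (if ballot_word bs then 0 else 1)" (is "card ?C = _")
proof -
  define h where "h = (\<lambda>i. ht (take i bs))"
  have h: "ht (take i bs) = h i" for i by (simp add: h_def)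
  define N where "N = length bs"
  \<comment> \<open>Dually, a removed descent ends at \<open>Suc i\<close>, strictly below
    everything up to \<open>i\<close> and weakly below everything later: the first minimum.\<close>
  have C: "i \<in> ?C \<longleftrightarrow> i < N \<and> (\<forall>j\<le>i. h (Suc i) < h j) \<and> (\<forall>j. i < j \<and> j \<le> N \<longrightarrow> h (Suc i) \<le> h j)" for i
  proof (cases "i < N")
    case True
    then have hS: "h (Suc i) = h i + (if bs ! i then 1 else -1)"
      by (simp add: h_def N_def ht_take_Suc)
    have "i \<in> ?C \<longleftrightarrow> \<not> bs ! i \<and> (\<forall>j\<le>i. h i \<le> h j) \<and> (\<forall>j. i < j \<and> j \<le> N \<longrightarrow> h (Suc i) \<le> h j)"
      using True by (simp add: N_def rev_ballot_word_take ballot_word_drop h Suc_le_eq)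
    also have "\<dots> \<longleftrightarrow> (\<forall>j\<le>i. h (Suc i) < h j) \<and> (\<forall>j. i < j \<and> j \<le> N \<longrightarrow> h (Suc i) \<le> h j)"
    proof (cases "bs ! i")
      case True
      with hS show ?thesis by auto
    next
      case False
      moreover have "h i - 1 < h j \<longleftrightarrow> h i \<le> h j" for j by linarith
      ultimately show ?thesis using hS by simp
    qed
    finally show ?thesis using True by simp
  qed (auto simp: N_def)
  \<comment> \<open>In a ballot word the first minimum is at position \<open>0\<close>, with no
    letter before it to remove.\<close>
  have B: "ballot_word bs \<longleftrightarrow> (\<forall>j\<le>N. h 0 \<le> h j)"
    using ballot_word_drop[of 0 bs] by (simp add: N_def h_def)
  show ?thesis
  proof (cases "ballot_word bs")
    case True
    have "i \<notin> ?C" for i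
    proof
      assume "i \<in> ?C"
      then have "Suc i \<le> N" "h (Suc i) < h 0" unfolding C by auto
      with B True show False by (meson not_le)
    qed
    then have "?C = {}" by blast
    with True show ?thesis by simp
  next
    case False
    define K where "K = {i. i \<le> N \<and> (\<forall>j\<le>N. h i \<le> h j)}"
    have "finite K" by (simp add: K_def)
    moreover have "K \<noteq> {}"
      using ex_is_arg_min_if_finite[of "{..N}" h] unfolding K_def is_arg_min_linorder by auto
    ultimately have L: "Min K \<in> K" by simp
    have earlier: "h (Min K) < h j" if "j < Min K" for j
    proof (rule ccontr)
      assume "\<not> h (Min K) < h j"
      then have "j \<in> K" using L that unfolding K_def by force
      then show False using Min_le[OF \<open>finite K\<close>] that by force
    qed
    have "Min K \<noteq> 0" using False B L by (auto simp: K_def)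
    then obtain i where i: "Min K = Suc i" using not0_implies_Suc by blast
    then have "i \<in> ?C" unfolding C using L earlier by (auto simp: K_def)
    moreover have "i = i'" if "i \<in> ?C" "i' \<in> ?C" for i i'
    proof (rule ccontr)
      have *: False if "i < i'" "i \<in> ?C" "i' \<in> ?C" for i i'
      proof -
        have "h (Suc i') < h (Suc i)" using that unfolding C by (simp add: Suc_le_eq)
        moreover have "h (Suc i) \<le> h (Suc i')" using that unfolding C by (simp add: Suc_le_eq)
        ultimately show False by simp
      qed
      assume "i \<noteq> i'"
      then show False using *[OF _ that] *[OF _ that(2,1)] by linarith
    qed
    ultimately have "?C = {i}" by blast
    with False show ?thesis by simp
  qed
qed

section \<open>Generating polynomials of ballot permutations and of descents\<close>

abbreviation descents :: "bool list \<Rightarrow> nat" where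
  "descents bs \<equiv> count_list bs False"

abbreviation ascents :: "bool list \<Rightarrow> nat" where
  "ascents bs \<equiv> count_list bs True"

lemma ascents_descents: "ascents bs + descents bs = length bs"
  by (induction bs) auto

definition word_sum :: "nat \<Rightarrow> (bool list \<Rightarrow> 'b::comm_monoid_add) \<Rightarrow> 'b" where
  "word_sum n f = (\<Sum>xs\<in>permutations_of_set {..<n}. f (updown xs))"

lemma word_sum_card:
  fixes S :: "nat set"
  assumes "finite S"
  shows "(\<Sum>xs\<in>permutations_of_set S. f (updown xs)) = word_sum (card S) f"
  unfolding word_sum_def by (rule sum_updown_card[OF assms])

lemma word_sum_0 [simp]: "word_sum 0 f = f []"
  by (simp add: word_sum_def)

section \<open>Binomial convolution and the polynomials counted by descents\<close>

definition binconv :: "(nat \<Rightarrow> 'b) \<Rightarrow> (nat \<Rightarrow> 'b) \<Rightarrow> nat \<Rightarrow> 'b::comm_semiring_1" where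
  "binconv f g n = (\<Sum>k\<le>n. of_nat (n choose k) * (f k * g (n - k)))"

lemma sum_Pow_binconv:
  assumes "finite S"
  shows "(\<Sum>T\<in>Pow S. f (card T) * g (card (S - T))) = binconv f g (card S)"
proof -
  have "(\<Sum>T\<in>Pow S. f (card T) * g (card (S - T))) = (\<Sum>T\<in>Pow S. f (card T) * g (card S - card T))"
    using assms by (intro sum.cong refl) (auto simp: card_Diff_subset finite_subset)
  also have "\<dots> = binconv f g (card S)"
    unfolding binconv_def by (rule sum_Pow_card[OF assms])
  finally show ?thesis .
qed

definition eulerian :: "nat \<Rightarrow> real poly" where
  "eulerian n = word_sum n (\<lambda>bs. monom 1 (descents bs))"

definition ballot_gf :: "nat \<Rightarrow> real poly" where
  "ballot_gf n = word_sum n (\<lambda>bs. if ballot_word bs then monom 1 (descents bs) else 0)"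

text \<open>For \<open>n > 0\<close> the word of a permutation of length \<open>n\<close> has \<open>n - 1\<close> letters, so
  \<open>Suc (descents bs) = n - ascents bs\<close>: this is the reciprocal polynomial
  \<open>t^n B(1/t)\<close> of \<open>ballot_gf n\<close>, counted through reversed permutations.\<close>
definition rev_ballot_gf :: "nat \<Rightarrow> real poly" where
  "rev_ballot_gf n = (if n = 0 then 1 else
     word_sum n (\<lambda>bs. if rev_ballot_word bs then monom 1 (Suc (descents bs)) else 0))"

lemma ballot_word_Nil [simp]: "ballot_word []" "rev_ballot_word []"
  by (auto simp: ballot_word_def rev_ballot_word_def)

text \<open>A cut strictly inside \<open>zs\<close> removes one letter of its up-down word. Because
  of the additional factor t in the left weight, its term is t^(des + 1) at an ascent and t^des at a
  descent. Ascent cuts are missing exactly when the cut after the last entry contributes, descent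
  cuts exactly when the cut before the first entry does, so each power arises once.\<close>

lemma sum_cuts:
  fixes zs :: "nat list"
  assumes "zs \<noteq> []"
  shows "(\<Sum>i\<le>length zs.
      (if take i zs = [] then 1 else if rev_ballot_word (updown (take i zs))
         then monom 1 (Suc (descents (updown (take i zs)))) else 0) *
      (if ballot_word (updown (drop i zs)) then monom 1 (descents (updown (drop i zs))) else 0)) =
    ([:1, 1:] * monom 1 (descents (updown zs)) :: real poly)" (is "(\<Sum>i\<le>_. ?g i * ?f i) = _")
proof -
  define bs where "bs = updown zs"
  define N where "N = length bs"
  have len: "length zs = Suc N" using assms by (cases zs) (auto simp: N_def bs_def)
  let ?R = "\<lambda>j. rev_ballot_word (take j bs) \<and> ballot_word (drop (Suc j) bs)"
  let ?d = "monom 1 (descents bs) :: real poly" and ?d1 = "monom 1 (Suc (descents bs)) :: real poly"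
  have mid: "?g (Suc j) * ?f (Suc j) = (if bs ! j \<and> ?R j then ?d1 else 0) + (if \<not> bs ! j \<and> ?R j then ?d else 0)"
    if "j < N" for j
  proof -
    have "descents bs = descents (take j bs @ bs ! j # drop (Suc j) bs)"
      using that id_take_nth_drop[of j bs] by (simp add: N_def)
    then have "descents bs = descents (take j bs) + (if bs ! j then 0 else 1) + descents (drop (Suc j) bs)"
      by simp
    with that assms show ?thesis
      by (simp add: updown_take updown_drop bs_def[symmetric] mult_monom)
  qed
  have count: "(\<Sum>j<N. if P j then c else 0) = of_nat (card {j. j < length bs \<and> P j}) * c"
    for P and c :: "real poly"
  proof -
    have "{..<N} \<inter> Collect P = {j. j < length bs \<and> P j}" by (auto simp: N_def)
    then show ?thesis by (simp add: sum.If_cases)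
  qed
  have "(\<Sum>i\<le>length zs. ?g i * ?f i) = ?g 0 * ?f 0 + (\<Sum>j<N. ?g (Suc j) * ?f (Suc j)) + ?g (Suc N) * ?f (Suc N)"
    unfolding len sum.atMost_shift sum.lessThan_Suc by (rule add.assoc[symmetric])
  also have "?g 0 * ?f 0 = (if ballot_word bs then ?d else 0)"
    by (simp add: bs_def)
  also have "?g (Suc N) * ?f (Suc N) = (if rev_ballot_word bs then ?d1 else 0)"
    using assms by (simp add: bs_def len)
  also have "(\<Sum>j<N. ?g (Suc j) * ?f (Suc j)) =
      (\<Sum>j<N. (if bs ! j \<and> ?R j then ?d1 else 0) + (if \<not> bs ! j \<and> ?R j then ?d else 0))"
    by (intro sum.cong refl mid) simp
  also have "\<dots> = (if rev_ballot_word bs then 0 else ?d1) + (if ballot_word bs then 0 else ?d)"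
    unfolding sum.distrib count card_cut_at_ascent card_cut_at_descent by simp
  finally have "(\<Sum>i\<le>length zs. ?g i * ?f i) = ?d + ?d1" by simp
  also have "\<dots> = [:1, 1:] * ?d"
    by (simp add: monom_Suc)
  finally show ?thesis by (simp add: bs_def)
qed

text \<open>The identity R B = E in positive degree: pairs of words on complementary letter sets are
  permutations with a cut, to which \<open>sum_cuts\<close> applies.\<close>

theorem binconv_ballot:
  assumes "n > 0"
  shows "binconv rev_ballot_gf ballot_gf n = [:1, 1:] * eulerian n"
proof -
  \<comment> \<open>An empty left part has weight 1, matching \<open>rev_ballot_gf 0\<close>; the
    formula for nonempty words would give it weight t.\<close>
  let ?g = "\<lambda>xs. if xs = [] then 1 else if rev_ballot_word (updown xs)
      then monom 1 (Suc (descents (updown xs))) else 0 :: real poly"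
  let ?f = "\<lambda>xs. if ballot_word (updown xs) then monom 1 (descents (updown xs)) else 0 :: real poly"
  have g: "(\<Sum>xs\<in>permutations_of_set T. ?g xs) = rev_ballot_gf (card T)" if "finite T" for T :: "nat set"
  proof (cases "T = {}")
    case False
    then have "(\<Sum>xs\<in>permutations_of_set T. ?g xs) = (\<Sum>xs\<in>permutations_of_set T.
        if rev_ballot_word (updown xs) then monom 1 (Suc (descents (updown xs))) else 0)"
      by (intro sum.cong) (auto simp: permutations_of_set_def)
    with False that show ?thesis
      by (simp add: rev_ballot_gf_def card_eq_0_iff flip: word_sum_card)
  qed (simp add: rev_ballot_gf_def)
  have f: "(\<Sum>xs\<in>permutations_of_set T. ?f xs) = ballot_gf (card T)" if "finite T" for T :: "nat set"
    using that by (simp add: ballot_gf_def flip: word_sum_card)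
  have "binconv rev_ballot_gf ballot_gf n = (\<Sum>T\<in>Pow {..<n}. rev_ballot_gf (card T) * ballot_gf (card ({..<n} - T)))"
    by (simp add: sum_Pow_binconv)
  also have "\<dots> = (\<Sum>T\<in>Pow {..<n}. \<Sum>xs\<in>permutations_of_set T. \<Sum>ys\<in>permutations_of_set ({..<n} - T). ?g xs * ?f ys)"
  proof (intro sum.cong refl)
    fix T assume "T \<in> Pow {..<n}"
    then have "finite T" "finite ({..<n} - T)" by (auto intro: finite_subset)
    then show "rev_ballot_gf (card T) * ballot_gf (card ({..<n} - T)) =
        (\<Sum>xs\<in>permutations_of_set T. \<Sum>ys\<in>permutations_of_set ({..<n} - T). ?g xs * ?f ys)"
      unfolding g[OF \<open>finite T\<close>, symmetric] f[OF \<open>finite ({..<n} - T)\<close>, symmetric]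
      by (simp only: sum_product)
  qed
  also have "\<dots> = (\<Sum>zs\<in>permutations_of_set {..<n}. \<Sum>i\<le>n. ?g (take i zs) * ?f (drop i zs))"
    unfolding sum_permutations_split[OF finite_lessThan] card_lessThan by (rule refl)
  also have "\<dots> = (\<Sum>zs\<in>permutations_of_set {..<n}. [:1, 1:] * monom 1 (descents (updown zs)))"
  proof (intro sum.cong refl)
    fix zs assume "zs \<in> permutations_of_set {..<n}"
    then have "length zs = n" using length_finite_permutations_of_set[of zs "{..<n}"] by simp
    then show "(\<Sum>i\<le>n. ?g (take i zs) * ?f (drop i zs)) = [:1, 1:] * monom 1 (descents (updown zs))"
      using sum_cuts[of zs] assms by fastforce
  qed
  also have "\<dots> = [:1, 1:] * eulerian n"
    by (simp add: eulerian_def word_sum_def sum_distrib_left)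
  finally show ?thesis .
qed

lemma updown_insert_max:
  assumes "\<And>x. x \<in> set xs \<union> set ys \<Longrightarrow> x < m"
  shows "updown (xs @ m # ys) =
    updown xs @ (if xs = [] then [] else [True]) @ (if ys = [] then [] else [False]) @ updown ys"
proof -
  have "updown (m # ys) = (if ys = [] then [] else [False]) @ updown ys"
  proof (cases ys)
    case (Cons y ys')
    then have "\<not> m < y" using assms[of y] by simp
    with Cons show ?thesis by simp
  qed simp
  moreover have "last xs < m" if "xs \<noteq> []"
    using assms[of "last xs"] that by simp
  ultimately show ?thesis
    using updown_append[of xs "m # ys"] by simp
qed

lemma eulerian_0 [simp]: "eulerian 0 = 1"
  by (simp add: eulerian_def)

text \<open>Split at the largest letter: the step up to it adds no descent, while the step down from
  it adds a factor t but occurs only if something follows.\<close>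

lemma eulerian_Suc:
  "eulerian (Suc n) = binconv eulerian (\<lambda>k. if k = 0 then 1 else [:0, 1:] * eulerian k) n"
proof -
  let ?e = "\<lambda>xs. monom 1 (descents (updown xs)) :: real poly"
  let ?f = "\<lambda>ys. if ys = [] then 1 else [:0, 1:] * ?e ys"
  have e: "(\<Sum>xs\<in>permutations_of_set T. ?e xs) = eulerian (card T)" if "finite T" for T :: "nat set"
    using that by (simp add: eulerian_def flip: word_sum_card)
  have f: "(\<Sum>ys\<in>permutations_of_set T. ?f ys) = (if card T = 0 then 1 else [:0, 1:] * eulerian (card T))"
    if "finite T" for T :: "nat set"
  proof (cases "T = {}")
    case False
    then have "(\<Sum>ys\<in>permutations_of_set T. ?f ys) = (\<Sum>ys\<in>permutations_of_set T. [:0, 1:] * ?e ys)"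
      by (intro sum.cong) (auto simp: permutations_of_set_def)
    with False that show ?thesis
      by (simp add: e sum_distrib_left[symmetric] del: mult_pCons_left)
  qed simp
  have "eulerian (Suc n) = (\<Sum>zs\<in>permutations_of_set (insert n {..<n}). ?e zs)"
    by (simp add: eulerian_def word_sum_def lessThan_Suc)
  also have "\<dots> = (\<Sum>T\<in>Pow {..<n}. \<Sum>xs\<in>permutations_of_set T. \<Sum>ys\<in>permutations_of_set ({..<n} - T).
      ?e (xs @ n # ys))"
    by (rule sum_permutations_insert) simp_all
  also have "\<dots> = (\<Sum>T\<in>Pow {..<n}. \<Sum>xs\<in>permutations_of_set T. \<Sum>ys\<in>permutations_of_set ({..<n} - T).
      ?e xs * ?f ys)"
  proof (intro sum.cong refl)
    fix T xs ys assume "T \<in> Pow {..<n}" "xs \<in> permutations_of_set T" "ys \<in> permutations_of_set ({..<n} - T)"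
    then have "updown (xs @ n # ys) =
        updown xs @ (if xs = [] then [] else [True]) @ (if ys = [] then [] else [False]) @ updown ys"
      by (intro updown_insert_max) (auto simp: permutations_of_set_def)
    then show "?e (xs @ n # ys) = ?e xs * ?f ys"
      by (simp add: mult_monom monom_Suc)
  qed
  also have "\<dots> = (\<Sum>T\<in>Pow {..<n}. eulerian (card T) *
      (\<lambda>k. if k = 0 then 1 else [:0, 1:] * eulerian k) (card ({..<n} - T)))"
  proof (intro sum.cong refl)
    fix T assume "T \<in> Pow {..<n}"
    then have "finite T" "finite ({..<n} - T)" by (auto intro: finite_subset)
    then show "(\<Sum>xs\<in>permutations_of_set T. \<Sum>ys\<in>permutations_of_set ({..<n} - T). ?e xs * ?f ys) =
        eulerian (card T) * (\<lambda>k. if k = 0 then 1 else [:0, 1:] * eulerian k) (card ({..<n} - T))"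
      unfolding e[OF \<open>finite T\<close>, symmetric] f[OF \<open>finite ({..<n} - T)\<close>, symmetric]
      by (simp only: sum_product)
  qed
  also have "\<dots> = binconv eulerian (\<lambda>k. if k = 0 then 1 else [:0, 1:] * eulerian k) n"
    by (subst sum_Pow_binconv) simp_all
  finally show ?thesis .
qed

section \<open>Exponential generating functions\<close>

definition egf :: "(nat \<Rightarrow> real poly) \<Rightarrow> real poly fps" where
  "egf f = Abs_fps (\<lambda>n. smult (1 / fact n) (f n))"

lemma egf_nth [simp]: "fps_nth (egf f) n = smult (1 / fact n) (f n)"
  by (simp add: egf_def)

lemma egf_deriv: "fps_deriv (egf f) = egf (\<lambda>n. f (Suc n))"
proof (rule fps_ext)
  fix n
  have "of_nat (Suc n) * smult (1 / fact (Suc n)) (f (Suc n)) = smult (real (Suc n) / fact (Suc n)) (f (Suc n))"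
    by (simp add: of_nat_poly del: of_nat_Suc fact_Suc)
  then show "fps_nth (fps_deriv (egf f)) n = fps_nth (egf (\<lambda>n. f (Suc n))) n"
    by (simp del: of_nat_Suc)
qed

lemma smult_sum_right: "smult c (sum f A) = (\<Sum>i\<in>A. smult c (f i))"
  by (induction A rule: infinite_finite_induct) (simp_all add: smult_add_right)

lemma egf_binconv: "egf (binconv f g) = egf f * egf g"
proof (rule fps_ext)
  fix n
  have "smult (1 / fact n) (of_nat (n choose k) * (f k * g (n - k))) =
      smult (1 / fact k) (f k) * smult (1 / fact (n - k)) (g (n - k))" if "k \<le> n" for k
    using that by (simp add: of_nat_poly binomial_fact field_simps)
  then show "fps_nth (egf (binconv f g)) n = fps_nth (egf f * egf g) n"
    by (simp add: binconv_def fps_mult_nth smult_sum_right atLeast0AtMost)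
qed

text \<open>Coefficient \<open>m\<close> of the equation expresses \<open>of_nat (Suc m)\<close>
  times coefficient \<open>Suc m\<close> through earlier ones, and this factor cancels in
  characteristic 0. Series can thus be identified by their differential equations, without closed
  forms.\<close>

lemma linear_ode_unique:
  fixes Y Z :: "real poly fps"
  assumes "fps_deriv Y = K * Y" "fps_deriv Z = K * Z" "fps_nth Y 0 = fps_nth Z 0"
  shows "Y = Z"
proof (rule fps_ext)
  fix n show "fps_nth Y n = fps_nth Z n"
  proof (induction n rule: less_induct)
    case (less n)
    show ?case
    proof (cases n)
      case (Suc m)
      have "fps_nth (fps_deriv Y) m = fps_nth (fps_deriv Z) m"
        unfolding assms fps_mult_nth using less Suc by (intro sum.cong) auto
      then have "of_nat (Suc m) * fps_nth Y (Suc m) = of_nat (Suc m) * fps_nth Z (Suc m)"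
        by simp
      then show ?thesis unfolding Suc by (simp del: of_nat_Suc)
    qed (simp add: assms)
  qed
qed

section \<open>Riccati equation and logarithmic derivative for the Eulerian series\<close>

definition tt :: "real poly fps" where "tt = fps_const [:0, 1:]"

lemma tt_simps [simp]:
  "fps_deriv tt = 0" "fps_nth (tt * F) n = [:0, 1:] * fps_nth F n" "fps_nth tt 0 = [:0, 1:]"
  "n > 0 \<Longrightarrow> fps_nth tt n = 0" "tt oo G = tt"
  by (simp_all add: tt_def)

text \<open>The constant term is removed so that E is \<open>1 + (1 + tt) * eul_egf\<close>.\<close>

definition eul_egf :: "real poly fps" where
  "eul_egf = egf eulerian - 1"

definition eul_egf_neg :: "real poly fps" where
  "eul_egf_neg = eul_egf oo (- fps_X)"

lemma eul_egf_0 [simp]: "fps_nth eul_egf 0 = 0" "fps_nth eul_egf_neg 0 = 0"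
  by (simp_all add: eul_egf_def eul_egf_neg_def fps_compose_uminus')

lemma eul_egf_nth: "n > 0 \<Longrightarrow> fps_nth eul_egf n = smult (1 / fact n) (eulerian n)"
  by (simp add: eul_egf_def)

text \<open>The Riccati equation: by \<open>eulerian_Suc\<close> the two factors count the parts
  before and after the maximum.\<close>

lemma eul_egf_deriv: "fps_deriv eul_egf = (1 + eul_egf) * (1 + tt * eul_egf)"
proof -
  have "egf (\<lambda>k. if k = 0 then 1 else [:0, 1:] * eulerian k) = 1 + tt * eul_egf"
  proof (rule fps_ext)
    fix n show "fps_nth (egf (\<lambda>k. if k = 0 then 1 else [:0, 1:] * eulerian k)) n = fps_nth (1 + tt * eul_egf) n"
      by (cases "n = 0") (simp_all add: eul_egf_nth)
  qed
  moreover have "fps_deriv (egf eulerian) =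
      egf eulerian * egf (\<lambda>k. if k = 0 then 1 else [:0, 1:] * eulerian k)"
    by (simp only: egf_deriv eulerian_Suc egf_binconv)
  moreover have "fps_deriv eul_egf = fps_deriv (egf eulerian)" "egf eulerian = 1 + eul_egf"
    by (simp_all add: eul_egf_def)
  ultimately show ?thesis by (simp only:)
qed

lemma eul_egf_neg_deriv: "fps_deriv eul_egf_neg = - ((1 + eul_egf_neg) * (1 + tt * eul_egf_neg))"
proof -
  have "fps_deriv eul_egf_neg = - (fps_deriv eul_egf oo (- fps_X))"
    unfolding eul_egf_neg_def using fps_compose_deriv[of "- fps_X" eul_egf] by simp
  also have "fps_deriv eul_egf oo (- fps_X) =
      ((1 + eul_egf) oo (- fps_X)) * ((1 + tt * eul_egf) oo (- fps_X))"
    unfolding eul_egf_deriv by (rule fps_compose_mult_distrib) simp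
  also have "\<dots> = (1 + eul_egf_neg) * (1 + tt * eul_egf_neg)"
    using fps_compose_mult_distrib[of "- fps_X" tt eul_egf]
    by (simp add: fps_compose_add_distrib eul_egf_neg_def)
  finally show ?thesis .
qed

text \<open>Equivalently, \<open>E(u) E(-u) = 1\<close> for \<open>E = 1 + (1 + t) A\<close>, so \<open>log E\<close> is odd.\<close>
lemma eul_egf_reflection: "eul_egf + eul_egf_neg + (1 + tt) * eul_egf * eul_egf_neg = 0"
\<comment> \<open>By the two Riccati equations the left-hand side W satisfies W' = t (A(u) - A(-u))
  W, and W(0) = 0; the zero series solves the same equation.\<close>
proof (rule linear_ode_unique[where K = "tt * (eul_egf - eul_egf_neg)"])
  show "fps_deriv (eul_egf + eul_egf_neg + (1 + tt) * eul_egf * eul_egf_neg) =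
    tt * (eul_egf - eul_egf_neg) * (eul_egf + eul_egf_neg + (1 + tt) * eul_egf * eul_egf_neg)"
  proof -
    have "(1 + a) * (1 + t * a) - (1 + b) * (1 + t * b) +
        (1 + t) * (a * - ((1 + b) * (1 + t * b)) + (1 + a) * (1 + t * a) * b) =
        t * (a - b) * (a + b + (1 + t) * a * b)" for a b t :: "real poly fps"
      by algebra
    from this[of eul_egf tt eul_egf_neg] show ?thesis
      by (simp add: eul_egf_deriv eul_egf_neg_deriv mult.assoc)
  qed
qed simp_all

text \<open>In the product on the right, the reflection identity replaces t (1 + t) A(u) A(-u) by -t
  (A(u) + A(-u)); what remains is (1 + t) (1 + A) (1 + t A), the derivative of E.\<close>

lemma eul_egf_log_deriv:
  "fps_deriv (1 + (1 + tt) * eul_egf) = (1 + tt + tt * (eul_egf + eul_egf_neg)) * (1 + (1 + tt) * eul_egf)"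
proof -
  have "(1 + t) * ((1 + a) * (1 + t * a)) = (1 + t + t * (a + b)) * (1 + (1 + t) * a)"
    if "a + b + (1 + t) * a * b = 0" for a b t :: "real poly fps"
    using that by algebra
  from this[OF eul_egf_reflection] show ?thesis
    by (simp add: eul_egf_deriv)
qed

text \<open>The exponential generating function of \<open>exp_seq w\<close> is the exponential of the integral of
  that of \<open>w\<close>; thus \<open>w k\<close> is the weight of the blocks of size \<open>k + 1\<close>.\<close>
fun exp_seq :: "(nat \<Rightarrow> 'b) \<Rightarrow> nat \<Rightarrow> 'b::comm_semiring_1" where
  "exp_seq w 0 = 1"
| "exp_seq w (Suc n) = (\<Sum>k\<le>n. of_nat (n choose k) * (w k * exp_seq w (n - k)))"

lemma exp_seq_Suc: "exp_seq w (Suc n) = binconv w (exp_seq w) n"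
  by (simp add: binconv_def)

lemma exp_seq_deriv: "fps_deriv (egf (exp_seq w)) = egf w * egf (exp_seq w)"
  unfolding egf_deriv exp_seq_Suc egf_binconv[symmetric] by (simp add: egf_def)

text \<open>Weight of the cycles on \<open>k + 1\<close> given elements, opened at the maximum into
  a word of \<open>k\<close> letters. The steps into and out of the maximum account for the two
  \<open>Suc\<close>; \<open>k = 0\<close> is a fixed point, where the minimum is 0.\<close>

definition min_cycle_gf :: "nat \<Rightarrow> real poly" where
  "min_cycle_gf k = (if k = 0 then 1 else if even k then
     word_sum k (\<lambda>bs. monom 1 (min (Suc (descents bs)) (Suc (ascents bs)))) else 0)"

text \<open>A fixed point has neither ascents nor descents, but must get weight \<open>t\<close> here, for the exponents
  of \<open>min_cycle_gf\<close> and \<open>max_cycle_gf\<close> to add up to the length of the cycle.\<close>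
definition max_cycle_gf :: "nat \<Rightarrow> real poly" where
  "max_cycle_gf k = (if k = 0 then [:0, 1:] else if even k then
     word_sum k (\<lambda>bs. monom 1 (max (Suc (descents bs)) (Suc (ascents bs)))) else 0)"

lemma count_list_map_Not: "count_list (map Not bs) b = count_list bs (\<not> b)"
  by (induction bs) auto

lemma word_sum_ascents: "word_sum n (\<lambda>bs. monom 1 (ascents bs)) = eulerian n"
proof -
  have "(\<Sum>xs\<in>rev ` permutations_of_set {..<n}. monom 1 (ascents (updown xs)) :: real poly) =
      (\<Sum>xs\<in>permutations_of_set {..<n}. monom 1 (ascents (updown (rev xs))))"
    by (subst sum.reindex) (simp_all add: inj_on_def)
  then have "word_sum n (\<lambda>bs. monom 1 (ascents bs) :: real poly) =
      (\<Sum>xs\<in>permutations_of_set {..<n}. monom 1 (ascents (updown (rev xs))))"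
    by (simp only: word_sum_def rev_permutations_of_set)
  also have "\<dots> = eulerian n"
    unfolding eulerian_def word_sum_def
    by (intro sum.cong refl) (simp add: permutations_of_set_def updown_rev count_list_map_Not)
  finally show ?thesis .
qed

text \<open>The sum of the powers with exponents min and max is the sum of the powers with the two
  original exponents, and by reversal each of these yields t times the Eulerian polynomial.
  Restricting to even \<open>n\<close> takes the even part of A; 1 + t comes from the fixed
  points.\<close>

lemma min_max_cycle_gf:
  "egf min_cycle_gf + egf max_cycle_gf = 1 + tt + tt * (eul_egf + eul_egf_neg)"
proof (rule fps_ext)
  fix n
  have *: "min_cycle_gf n + max_cycle_gf n = 2 * ([:0, 1:] * eulerian n)" if "n > 0" "even n"
  proof -
    have t: "monom 1 (Suc k) = ([:0, 1:] * monom 1 k :: real poly)" for k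
      by (simp add: monom_Suc)
    have mm: "monom 1 (min a b) + monom 1 (max a b) = (monom 1 a + monom 1 b :: real poly)" for a b :: nat
      by (simp add: min_def max_def)
    have "min_cycle_gf n + max_cycle_gf n =
        word_sum n (\<lambda>bs. monom 1 (min (Suc (descents bs)) (Suc (ascents bs))) +
          monom 1 (max (Suc (descents bs)) (Suc (ascents bs))))"
      using that unfolding word_sum_def sum.distrib
      by (simp only: min_cycle_gf_def max_cycle_gf_def word_sum_def) simp
    also have "\<dots> = word_sum n (\<lambda>bs. monom 1 (Suc (descents bs)) + monom 1 (Suc (ascents bs)))"
      by (simp only: mm)
    also have "\<dots> =
        [:0, 1:] * eulerian n + [:0, 1:] * word_sum n (\<lambda>bs. monom 1 (ascents bs))"
      unfolding eulerian_def word_sum_def t sum.distrib sum_distrib_left by (rule refl)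
    finally show ?thesis by (simp add: word_sum_ascents)
  qed
  consider "n = 0" | "n > 0" "even n" | "odd n" by fastforce
  then show "fps_nth (egf min_cycle_gf + egf max_cycle_gf) n =
      fps_nth (1 + tt + tt * (eul_egf + eul_egf_neg)) n"
  proof cases
    case 1
    then show ?thesis by (simp add: min_cycle_gf_def max_cycle_gf_def one_pCons)
  next
    case 2
    then have "fps_nth (eul_egf + eul_egf_neg) n = smult (1 / fact n) (2 * eulerian n)"
      by (simp add: eul_egf_neg_def fps_compose_uminus' eul_egf_nth)
    with 2 *[OF 2] show ?thesis
      by (simp add: smult_add_right[symmetric])
  next
    case 3
    then have "n > 0" by (cases n) auto
    with 3 show ?thesis
      by (simp add: min_cycle_gf_def max_cycle_gf_def eul_egf_neg_def fps_compose_uminus')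
  qed
qed

text \<open>Logarithmic derivatives add, so by \<open>min_max_cycle_gf\<close> the product O' O has
  the same logarithmic derivative as E, and the same constant term.\<close>

theorem binconv_cycles:
  assumes "n > 0"
  shows "binconv (exp_seq max_cycle_gf) (exp_seq min_cycle_gf) n = [:1, 1:] * eulerian n"
proof -
  let ?Z = "egf (exp_seq max_cycle_gf) * egf (exp_seq min_cycle_gf)"
  have "?Z = 1 + (1 + tt) * eul_egf"
  proof (rule linear_ode_unique)
    show "fps_deriv ?Z = (1 + tt + tt * (eul_egf + eul_egf_neg)) * ?Z"
      unfolding min_max_cycle_gf[symmetric]
      by (simp add: exp_seq_deriv algebra_simps)
    show "fps_deriv (1 + (1 + tt) * eul_egf) = (1 + tt + tt * (eul_egf + eul_egf_neg)) * (1 + (1 + tt) * eul_egf)"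
      by (rule eul_egf_log_deriv)
  qed simp
  then have "fps_nth (egf (binconv (exp_seq max_cycle_gf) (exp_seq min_cycle_gf))) n =
      fps_nth (1 + (1 + tt) * eul_egf) n"
    by (simp add: egf_binconv)
  also have "1 + tt = fps_const [:1, 1:]"
    unfolding tt_def fps_const_1_eq_1[symmetric] fps_const_add by (simp add: one_pCons)
  finally show ?thesis using assms
    by (simp add: eul_egf_nth smult_eq_iff del: mult_pCons_left)
qed

section \<open>Uniqueness of the factorization\<close>

lemma coeff_mult_nonzeroE:
  assumes "coeff (p * q) d \<noteq> 0"
  obtains i j where "d = i + j" "coeff p i \<noteq> 0" "coeff q j \<noteq> 0"
proof -
  from assms obtain i where "i \<in> {..d}" "coeff p i * coeff q (d - i) \<noteq> 0"
    unfolding coeff_mult by (rule sum.not_neutral_contains_not_neutral)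
  moreover from this have "coeff p i \<noteq> 0" "coeff q (d - i) \<noteq> 0" by auto
  ultimately show ?thesis using that[of i "d - i"] by simp
qed

lemma coeff_sum_nonzeroE:
  assumes "coeff (\<Sum>x\<in>A. f x) d \<noteq> 0"
  obtains x where "x \<in> A" "coeff (f x) d \<noteq> 0"
  using assms unfolding coeff_sum by (rule sum.not_neutral_contains_not_neutral)

lemma coeff_word_sum_nonzeroE:
  assumes "coeff (word_sum n f) d \<noteq> 0"
  obtains bs where "length bs = n - 1" "coeff (f bs) d \<noteq> 0"
proof -
  from assms obtain xs where xs: "xs \<in> permutations_of_set {..<n}" "coeff (f (updown xs)) d \<noteq> 0"
    unfolding word_sum_def by (rule coeff_sum_nonzeroE)
  then have "length (updown xs) = n - 1"
    using length_finite_permutations_of_set[of xs "{..<n}"] by simp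
  with xs(2) show ?thesis using that by blast
qed

lemma coeff_binconv_nonzeroE:
  fixes f g :: "nat \<Rightarrow> real poly"
  assumes "coeff (binconv f g n) d \<noteq> 0"
  obtains k i j where "k \<le> n" "d = i + j" "coeff (f k) i \<noteq> 0" "coeff (g (n - k)) j \<noteq> 0"
proof -
  from assms obtain k where k: "k \<in> {..n}" "coeff (of_nat (n choose k) * (f k * g (n - k))) d \<noteq> 0"
    unfolding binconv_def by (rule coeff_sum_nonzeroE)
  then have "coeff (f k * g (n - k)) d \<noteq> 0"
    by (simp add: of_nat_poly)
  then show ?thesis using k(1) that by (elim coeff_mult_nonzeroE) auto
qed

text \<open>A ballot path ends at height at least 0, so at most half of its \<open>n - 1\<close>
  steps are descents.\<close>

lemma coeff_ballot_gf_nonzero: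
  assumes "coeff (ballot_gf n) d \<noteq> 0" "n > 0"
  shows "2 * d < n"
proof -
  from assms(1) obtain bs where bs: "length bs = n - 1"
      "coeff (if ballot_word bs then monom 1 (descents bs) else 0 :: real poly) d \<noteq> 0"
    unfolding ballot_gf_def by (rule coeff_word_sum_nonzeroE)
  then have "ballot_word bs" "d = descents bs" by (auto split: if_splits)
  moreover from this(1) have "0 \<le> ht bs" unfolding ballot_word_def by force
  ultimately show ?thesis using ascents_descents[of bs] bs(1) assms(2) by (simp add: ht_def)
qed

text \<open>At least half of the \<open>n - 1\<close> steps are descents here, and the additional
  factor t makes the bound strict.\<close>

lemma coeff_rev_ballot_gf_nonzero:
  assumes "coeff (rev_ballot_gf n) d \<noteq> 0" "n > 0"
  shows "n < 2 * d"
proof -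
  from assms obtain bs where bs: "length bs = n - 1"
      "coeff (if rev_ballot_word bs then monom 1 (Suc (descents bs)) else 0 :: real poly) d \<noteq> 0"
    unfolding rev_ballot_gf_def by (auto elim: coeff_word_sum_nonzeroE)
  then have "rev_ballot_word bs" "d = Suc (descents bs)" by (auto split: if_splits)
  moreover from this(1) have "ht bs \<le> 0" unfolding rev_ballot_word_def by force
  ultimately show ?thesis using ascents_descents[of bs] bs(1) assms(2) by (simp add: ht_def)
qed

text \<open>For even \<open>k > 0\<close> the two numbers under the minimum add up to the odd cycle
  length \<open>k + 1\<close>; they therefore differ, and the smaller one is strictly below
  half.\<close>

lemma coeff_min_cycle_gf_nonzero:
  assumes "coeff (min_cycle_gf k) d \<noteq> 0"
  shows "2 * d < k + 1"
proof (cases "k = 0")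
  case True
  with assms show ?thesis by (auto simp: min_cycle_gf_def split: if_splits)
next
  case False
  with assms have k: "even k" by (auto simp: min_cycle_gf_def split: if_splits)
  with assms False obtain bs where bs: "length bs = k - 1"
      "coeff (monom 1 (min (Suc (descents bs)) (Suc (ascents bs))) :: real poly) d \<noteq> 0"
    unfolding min_cycle_gf_def by (auto elim: coeff_word_sum_nonzeroE)
  then have "d = min (Suc (descents bs)) (Suc (ascents bs))" by (auto split: if_splits)
  moreover have "Suc (descents bs) + Suc (ascents bs) = k + 1"
    using ascents_descents[of bs] bs(1) False by simp
  ultimately have "2 * d \<le> k + 1" by linarith
  moreover have "2 * d \<noteq> k + 1" using k by presburger
  ultimately show ?thesis by linarith
qed

lemma coeff_max_cycle_gf_nonzero:
  assumes "coeff (max_cycle_gf k) d \<noteq> 0"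
  shows "k + 1 < 2 * d"
proof (cases "k = 0")
  case True
  with assms show ?thesis by (cases d) (auto simp: max_cycle_gf_def)
next
  case False
  with assms have k: "even k" by (auto simp: max_cycle_gf_def split: if_splits)
  with assms False obtain bs where bs: "length bs = k - 1"
      "coeff (monom 1 (max (Suc (descents bs)) (Suc (ascents bs))) :: real poly) d \<noteq> 0"
    unfolding max_cycle_gf_def by (auto elim: coeff_word_sum_nonzeroE)
  then have "d = max (Suc (descents bs)) (Suc (ascents bs))" by (auto split: if_splits)
  moreover have "Suc (descents bs) + Suc (ascents bs) = k + 1"
    using ascents_descents[of bs] bs(1) False by simp
  ultimately have "k + 1 \<le> 2 * d" by linarith
  moreover have "2 * d \<noteq> k + 1" using k by presburger
  ultimately show ?thesis by linarith
qed

text \<open>The bounds add up over the blocks. The weak bound covers a possibly empty remainder; the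
  first block supplies strictness.\<close>

lemma coeff_exp_seq_min_nonzero:
  "coeff (exp_seq min_cycle_gf n) d \<noteq> 0 \<Longrightarrow> 2 * d \<le> n \<and> (n > 0 \<longrightarrow> 2 * d < n)"
proof (induction n arbitrary: d rule: less_induct)
  case (less n)
  show ?case
  proof (cases n)
    case 0
    with less.prems show ?thesis by (auto split: if_splits)
  next
    case (Suc m)
    from less.prems[unfolded Suc exp_seq_Suc] obtain k i j where kij: "k \<le> m" "d = i + j"
        "coeff (min_cycle_gf k) i \<noteq> 0" "coeff (exp_seq min_cycle_gf (m - k)) j \<noteq> 0"
      by (rule coeff_binconv_nonzeroE)
    have "2 * i < k + 1" using kij(3) by (rule coeff_min_cycle_gf_nonzero)
    moreover have "2 * j \<le> m - k" using less.IH[of "m - k" j] kij Suc by simp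
    ultimately show ?thesis using kij(1,2) Suc by arith
  qed
qed

lemma coeff_exp_seq_max_nonzero:
  "coeff (exp_seq max_cycle_gf n) d \<noteq> 0 \<Longrightarrow> n \<le> 2 * d \<and> (n > 0 \<longrightarrow> n < 2 * d)"
proof (induction n arbitrary: d rule: less_induct)
  case (less n)
  show ?case
  proof (cases n)
    case 0
    with less.prems show ?thesis by simp
  next
    case (Suc m)
    from less.prems[unfolded Suc exp_seq_Suc] obtain k i j where kij: "k \<le> m" "d = i + j"
        "coeff (max_cycle_gf k) i \<noteq> 0" "coeff (exp_seq max_cycle_gf (m - k)) j \<noteq> 0"
      by (rule coeff_binconv_nonzeroE)
    have "k + 1 < 2 * i" using kij(3) by (rule coeff_max_cycle_gf_nonzero)
    moreover have "m - k \<le> 2 * j" using less.IH[of "m - k" j] kij Suc by simp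
    ultimately show ?thesis using kij(1,2) Suc by arith
  qed
qed

text \<open>By induction all terms of the convolutions except the two outer ones agree, leaving
  \<open>F n + G n = F' n + G' n\<close>. The exponents of the two summands lie on opposite sides of
  n/2, so the summands can be read off separately.\<close>

lemma binconv_factorization_unique:
  fixes F G F' G' :: "nat \<Rightarrow> real poly"
  assumes eq: "\<And>n. n > 0 \<Longrightarrow> binconv G F n = binconv G' F' n"
    and init: "F 0 = 1" "G 0 = 1" "F' 0 = 1" "G' 0 = 1"
    and F: "\<And>n d. n > 0 \<Longrightarrow> coeff (F n) d \<noteq> 0 \<Longrightarrow> 2 * d < n"
    and F': "\<And>n d. n > 0 \<Longrightarrow> coeff (F' n) d \<noteq> 0 \<Longrightarrow> 2 * d < n"
    and G: "\<And>n d. n > 0 \<Longrightarrow> coeff (G n) d \<noteq> 0 \<Longrightarrow> n < 2 * d"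
    and G': "\<And>n d. n > 0 \<Longrightarrow> coeff (G' n) d \<noteq> 0 \<Longrightarrow> n < 2 * d"
  shows "F n = F' n \<and> G n = G' n"
proof (induction n rule: less_induct)
  case (less n)
  show ?case
  proof (cases n)
    case 0
    then show ?thesis by (simp add: init)
  next
    case (Suc m)
    have split: "binconv H K n = K n + (\<Sum>k<m. of_nat (n choose Suc k) * (H (Suc k) * K (m - k))) + H n"
      if "H 0 = 1" "K 0 = 1" for H K :: "nat \<Rightarrow> real poly"
      unfolding binconv_def Suc sum.atMost_shift sum.lessThan_Suc using that by (simp add: add.assoc)
    define X where "X = (\<Sum>k<m. of_nat (n choose Suc k) * (G (Suc k) * F (m - k)))"
    have "X = (\<Sum>k<m. of_nat (n choose Suc k) * (G' (Suc k) * F' (m - k)))"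
      unfolding X_def using less Suc by (intro sum.cong refl) simp
    then have "F n + X + G n = F' n + X + G' n"
      using eq[of n] Suc unfolding split[of G F, OF init(2,1)] split[of G' F', OF init(4,3)] X_def[symmetric] by simp
    then have sum_eq: "F n + G n = F' n + G' n"
      by simp
    have "coeff (F n) d = coeff (F' n) d \<and> coeff (G n) d = coeff (G' n) d" for d
    proof -
      have c: "coeff (F n) d + coeff (G n) d = coeff (F' n) d + coeff (G' n) d"
        using sum_eq by (metis coeff_add)
      show ?thesis
      proof (cases "2 * d < n")
        case True
        then have "coeff (G n) d = 0" "coeff (G' n) d = 0" using G[of n d] G'[of n d] Suc by auto
        with c show ?thesis by simp
      next
        case False
        then have "coeff (F n) d = 0" "coeff (F' n) d = 0" using F[of n d] F'[of n d] Suc by auto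
        with c show ?thesis by simp
      qed
    qed
    then show ?thesis by (simp add: poly_eq_iff)
  qed
qed

theorem ballot_gf_eq_exp_seq: "ballot_gf n = exp_seq min_cycle_gf n"
proof -
  have "ballot_gf n = exp_seq min_cycle_gf n \<and> rev_ballot_gf n = exp_seq max_cycle_gf n"
  proof (rule binconv_factorization_unique)
    show "binconv rev_ballot_gf ballot_gf n = binconv (exp_seq max_cycle_gf) (exp_seq min_cycle_gf) n"
      if "n > 0" for n
      using that by (simp add: binconv_ballot binconv_cycles)
    show "ballot_gf 0 = 1" "rev_ballot_gf 0 = 1" by (simp_all add: ballot_gf_def rev_ballot_gf_def)
    fix n d :: nat assume n: "n > 0"
    show "2 * d < n" if "coeff (ballot_gf n) d \<noteq> 0"
      using coeff_ballot_gf_nonzero[OF that n] .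
    show "n < 2 * d" if "coeff (rev_ballot_gf n) d \<noteq> 0"
      using coeff_rev_ballot_gf_nonzero[OF that n] .
    show "2 * d < n" if "coeff (exp_seq min_cycle_gf n) d \<noteq> 0"
      using coeff_exp_seq_min_nonzero[OF that] n by blast
    show "n < 2 * d" if "coeff (exp_seq max_cycle_gf n) d \<noteq> 0"
      using coeff_exp_seq_max_nonzero[OF that] n by blast
  qed simp_all
  then show ?thesis by simp
qed

section \<open>Odd order permutations\<close>

text \<open>The setting for removing one cycle: \<open>m # ys\<close> lists the cycle of
  \<open>m\<close> in the order in which \<open>p\<close> runs through it, and \<open>q\<close> acts
  on the elements outside it.\<close>

locale cycle_composition =
  fixes m :: nat and S T :: "nat set" and ys :: "nat list" and q p :: "nat \<Rightarrow> nat"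
  assumes m: "m \<notin> S" and T: "T \<subseteq> S" and ys: "set ys = T" "distinct ys"
    and q: "q permutes S - T" and p_def: "p = cycle_of_list (m # ys) \<circ> q"
begin

lemma distinct_cycle: "distinct (m # ys)" and set_cycle: "set (m # ys) = insert m T"
  using m T ys by auto

lemma p_cycle: "x \<in> set (m # ys) \<Longrightarrow> p x = cycle_of_list (m # ys) x"
proof -
  assume "x \<in> set (m # ys)"
  then have "x \<notin> S - T" using m T ys by auto
  then show ?thesis using permutes_not_in[OF q] by (simp add: p_def)
qed

lemma p_rest: "x \<in> S - T \<Longrightarrow> p x = q x"
proof -
  assume "x \<in> S - T"
  then have "q x \<in> S - T" using permutes_in_image[OF q] by simp
  then have "q x \<notin> set (m # ys)" using m T ys by auto
  then show ?thesis unfolding p_def comp_apply by (rule id_outside_supp)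
qed

lemma funpow_cycle: "x \<in> set (m # ys) \<Longrightarrow>
    (p ^^ k) x = (cycle_of_list (m # ys) ^^ k) x \<and> (p ^^ k) x \<in> set (m # ys)"
proof (induction k)
  case (Suc k)
  then have mem: "(p ^^ k) x \<in> set (m # ys)" and IH: "(p ^^ k) x = (cycle_of_list (m # ys) ^^ k) x"
    by blast+
  have eq: "(p ^^ Suc k) x = cycle_of_list (m # ys) ((p ^^ k) x)"
    using p_cycle[OF mem] by (simp only: funpow.simps comp_apply)
  show ?case
  proof
    show "(p ^^ Suc k) x = (cycle_of_list (m # ys) ^^ Suc k) x"
      using eq by (simp only: funpow.simps comp_apply IH)
    show "(p ^^ Suc k) x \<in> set (m # ys)"
      unfolding eq using mem permutes_in_image[OF cycle_permutes[of "m # ys"]] by blast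
  qed
qed simp

lemma funpow_nth: "i < length (m # ys) \<Longrightarrow> (p ^^ k) ((m # ys) ! i) = (m # ys) ! ((k + i) mod length (m # ys))"
proof -
  assume i: "i < length (m # ys)"
  then have "(p ^^ k) ((m # ys) ! i) = map (cycle_of_list (m # ys) ^^ k) (m # ys) ! i"
    using funpow_cycle[of "(m # ys) ! i" k] nth_mem[OF i] nth_map[OF i] by metis
  also have "\<dots> = rotate k (m # ys) ! i"
    by (simp only: cyclic_rotation[OF distinct_cycle])
  also have "\<dots> = (m # ys) ! ((k + i) mod length (m # ys))"
    by (rule nth_rotate[OF i])
  finally show ?thesis .
qed

lemma cyc_cycle: "x \<in> set (m # ys) \<Longrightarrow> cyc p x = set (m # ys)"
proof -
  assume x: "x \<in> set (m # ys)"
  then obtain i where i: "i < length (m # ys)" "x = (m # ys) ! i"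
    by (metis in_set_conv_nth)
  let ?N = "length (m # ys)"
  show ?thesis
  proof (intro equalityI subsetI)
    fix y assume "y \<in> cyc p x"
    then obtain k where "y = (p ^^ k) x" unfolding cyc_def by blast
    then show "y \<in> set (m # ys)" using funpow_cycle[OF x, of k] by blast
  next
    fix y assume "y \<in> set (m # ys)"
    then obtain j where j: "j < ?N" "y = (m # ys) ! j" by (metis in_set_conv_nth)
    \<comment> \<open>From index \<open>i\<close>, \<open>?N - i\<close> iterations lead back to
      \<open>m\<close>, and \<open>j\<close> more to index \<open>j\<close>.\<close>
    have "(?N - i + j + i) mod ?N = j"
    proof -
      have "?N - i + j + i = j + ?N" using i(1) by linarith
      then show ?thesis using j(1) by (simp only: mod_add_self2 mod_less)
    qed
    then have "y = (p ^^ (?N - i + j)) x"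
      using funpow_nth[OF i(1), of "?N - i + j"] by (simp only: i(2) j(2))
    then show "y \<in> cyc p x" unfolding cyc_def by blast
  qed
qed

lemma funpow_rest: "x \<in> S - T \<Longrightarrow> (p ^^ k) x = (q ^^ k) x \<and> (q ^^ k) x \<in> S - T"
proof (induction k)
  case (Suc k)
  then have "(q ^^ Suc k) x \<in> S - T" using permutes_in_image[OF q] by simp
  moreover have "(p ^^ Suc k) x = (q ^^ Suc k) x" using Suc p_rest by simp
  ultimately show ?case by simp
qed simp

lemma cyc_rest: "x \<in> S - T \<Longrightarrow> cyc p x = cyc q x \<and> cyc q x \<subseteq> S - T"
  using funpow_rest[of x] by (auto simp: cyc_def)

lemma cycles_image: "cyc p ` insert m S = insert (set (m # ys)) (cyc q ` (S - T))"
proof -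
  have "insert m S = set (m # ys) \<union> (S - T)" using T ys by auto
  then have 1: "cyc p ` insert m S = cyc p ` set (m # ys) \<union> cyc p ` (S - T)"
    by (simp only: image_Un)
  have 2: "cyc p ` set (m # ys) = {set (m # ys)}"
  proof -
    have "cyc p ` set (m # ys) = (\<lambda>_. set (m # ys)) ` set (m # ys)"
      by (intro image_cong refl) (rule cyc_cycle)
    also have "\<dots> = {set (m # ys)}" by auto
    finally show ?thesis .
  qed
  have 3: "cyc p ` (S - T) = cyc q ` (S - T)"
    by (intro image_cong refl) (use cyc_rest in blast)
  show ?thesis unfolding 1 2 3 by (rule insert_is_Un[symmetric])
qed

lemma cycle_notin: "set (m # ys) \<notin> cyc q ` (S - T)"
proof
  assume "set (m # ys) \<in> cyc q ` (S - T)"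
  then obtain x where "x \<in> S - T" "set (m # ys) = cyc q x" by blast
  then have "m \<in> S" using cyc_rest[of x] by auto
  with m show False by simp
qed

lemma map_p: "map p (m # ys) = ys @ [m]"
proof -
  have "map p (m # ys) = map (cycle_of_list (m # ys) ^^ 1) (m # ys)"
    using p_cycle by simp
  also have "\<dots> = rotate 1 (m # ys)" by (rule cyclic_rotation[OF distinct_cycle])
  finally show ?thesis by simp
qed

lemma no_fixpoint:
  assumes "ys \<noteq> []" "x \<in> set (m # ys)"
  shows "p x \<noteq> x"
proof
  assume fp: "p x = x"
  have "(p ^^ k) x = x" for k by (induction k) (simp_all add: fp)
  then have "cyc p x = {x}" by (auto simp: cyc_def)
  with cyc_cycle[OF assms(2)] have "set (m # ys) = {x}" by simp
  with assms(1) distinct_cycle show False by (cases ys) auto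
qed

end

lemma updown_conv_map2: "updown (x # ys) = map2 (<) (x # ys) ys"
  by (induction ys arbitrary: x) auto

lemma map2_self_map: "map2 f xs (map g xs) = map (\<lambda>x. f x (g x)) xs"
  by (induction xs) auto

lemma count_list_map_bool: "count_list (map P xs) b = length (filter (\<lambda>x. P x = b) xs)"
  by (induction xs) auto

context cycle_composition
begin

text \<open>The gaps of the closed word \<open>m # ys @ [m]\<close> compare each \<open>y\<close> of
  the cycle with \<open>p y\<close>. As \<open>m\<close> is the maximum, the first gap is a descent
  and the last one an ascent; between them stands \<open>updown ys\<close>.\<close>

lemma casc_cdes:
  assumes max: "\<And>x. x \<in> S \<Longrightarrow> x < m" and "ys \<noteq> []"
  shows "casc p (set (m # ys)) = Suc (ascents (updown ys))"
    and "cdes p (set (m # ys)) = Suc (descents (updown ys))"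
proof -
  have "updown (m # ys @ [m]) = map2 (<) (m # ys @ [m]) (map p (m # ys))"
    unfolding map_p by (rule updown_conv_map2)
  also have "\<dots> = map2 (<) (m # ys) (map p (m # ys))"
    using zip_append1[of "m # ys" "[m]" "map p (m # ys)"] by simp
  also have "\<dots> = map (\<lambda>y. y < p y) (m # ys)"
    by (rule map2_self_map)
  finally have 1: "updown (m # ys @ [m]) = map (\<lambda>y. y < p y) (m # ys)" .
  obtain y ys' where y: "ys = y # ys'" using assms(2) by (cases ys) auto
  have "y < m" "last ys < m" using max T ys(1) y last_in_set[OF assms(2)] by auto
  then have 2: "updown (m # ys @ [m]) = False # updown ys @ [True]"
    using updown_append[of ys "[m]"] y by simp
  have *: "card {y \<in> set (m # ys). P y} = length (filter P (m # ys))" for P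
    using distinct_length_filter[OF distinct_cycle, of P] by (simp add: Int_def conj_commute)
  have "casc p (set (m # ys)) = ascents (updown (m # ys @ [m]))"
    unfolding casc_def * 1 count_list_map_bool by simp
  then show "casc p (set (m # ys)) = Suc (ascents (updown ys))"
    unfolding 2 by simp
  \<comment> \<open>\<open>descents\<close> counts the \<open>y\<close> for which
    \<open>y < p y\<close> fails; these are cyclic descents because a cycle of length at least 2 has
    no fixed point.\<close>
  have "filter (\<lambda>y. p y < y) (m # ys) = filter (\<lambda>y. (y < p y) = False) (m # ys)"
  proof (rule filter_cong[OF refl])
    fix y assume "y \<in> set (m # ys)"
    then have "p y \<noteq> y" by (rule no_fixpoint[OF assms(2)])
    then show "(p y < y) = ((y < p y) = False)" by auto
  qed
  then have "cdes p (set (m # ys)) = descents (updown (m # ys @ [m]))"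
    unfolding cdes_def * 1 count_list_map_bool by simp
  then show "cdes p (set (m # ys)) = Suc (descents (updown ys))"
    unfolding 2 by simp
qed

end

text \<open>This and \<open>M_on\<close> extend \<open>odd_order\<close> and \<open>M\<close> to
  arbitrary ground sets, since removing a cycle need not leave an interval.\<close>

definition odd_on :: "nat set \<Rightarrow> (nat \<Rightarrow> nat) \<Rightarrow> bool" where
  "odd_on S p \<longleftrightarrow> (\<forall>c\<in>cyc p ` S. odd (card c))"

definition M_on :: "nat set \<Rightarrow> (nat \<Rightarrow> nat) \<Rightarrow> nat" where
  "M_on S p = (\<Sum>c\<in>cyc p ` S. min (cdes p c) (casc p c))"

text \<open>For a fixed point both cyclic counts are 0, whereas the formula for nonempty
  \<open>ys\<close> would give 1.\<close>

definition cycle_min :: "nat list \<Rightarrow> nat" where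
  "cycle_min ys = (if ys = [] then 0 else min (Suc (descents (updown ys))) (Suc (ascents (updown ys))))"

context cycle_composition
begin

lemma odd_on_insert: "odd_on (insert m S) p \<longleftrightarrow> even (card T) \<and> odd_on (S - T) q"
proof -
  have "card (set (m # ys)) = Suc (card T)"
    using distinct_card[OF distinct_cycle] distinct_card[OF ys(2)] ys(1) by simp
  then show ?thesis unfolding odd_on_def cycles_image by simp
qed

lemma M_on_insert:
  assumes "finite S" and max: "\<And>x. x \<in> S \<Longrightarrow> x < m"
  shows "M_on (insert m S) p = cycle_min ys + M_on (S - T) q"
proof -
  have "min (cdes p (set (m # ys))) (casc p (set (m # ys))) = cycle_min ys"
  proof (cases "ys = []")
    case True
    then have "{y \<in> set (m # ys). p y < y} = {}" using map_p by auto
    then have "cdes p (set (m # ys)) = 0" unfolding cdes_def by (simp only: card.empty)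
    with True show ?thesis by (simp add: cycle_min_def del: set_simps)
  next
    case False
    with casc_cdes[OF max False] show ?thesis by (simp add: cycle_min_def)
  qed
  moreover have "(\<Sum>c\<in>cyc q ` (S - T). min (cdes p c) (casc p c)) = M_on (S - T) q"
    unfolding M_on_def
  proof (rule sum.cong[OF refl])
    fix c assume "c \<in> cyc q ` (S - T)"
    then have "p x = q x" if "x \<in> c" for x using that cyc_rest p_rest by blast
    then show "min (cdes p c) (casc p c) = min (cdes q c) (casc q c)"
      by (simp add: cdes_def casc_def cong: conj_cong)
  qed
  ultimately show ?thesis
    unfolding M_on_def cycles_image using cycle_notin assms(1) by (simp del: set_simps)
qed

end

text \<open>The inverse reads off the cycle of \<open>m\<close>, starting at \<open>m\<close>, and
  restricts the permutation to the remaining elements.\<close>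

lemma bij_betw_cycle_composition:
  fixes S :: "nat set"
  assumes "finite S" "m \<notin> S"
  shows "bij_betw (\<lambda>(T, ys, q). cycle_of_list (m # ys) \<circ> q)
    (SIGMA T:Pow S. permutations_of_set T \<times> {q. q permutes S - T}) {p. p permutes insert m S}"
    (is "bij_betw ?f ?Q ?P")
proof (rule bij_betw_imageI)
  have cc: "cycle_composition m S T ys q (?f (T, ys, q))" if "(T, ys, q) \<in> ?Q" for T ys q
    using that assms by (auto simp: cycle_composition_def permutations_of_set_def)
  show "inj_on ?f ?Q"
  proof (rule inj_onI)
    fix a a' assume a: "a \<in> ?Q" "a' \<in> ?Q" and eq: "?f a = ?f a'"
    obtain T ys q where A: "a = (T, ys, q)" by (cases a)
    obtain T' ys' q' where A': "a' = (T', ys', q')" by (cases a')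
    interpret c: cycle_composition m S T ys q "?f (T, ys, q)" using cc a(1) A by blast
    interpret c': cycle_composition m S T' ys' q' "?f (T, ys, q)" using cc[of T' ys' q'] a(2) A A' eq by simp
    have set_eq: "set (m # ys) = set (m # ys')"
      using c.cyc_cycle[of m] c'.cyc_cycle[of m] by simp
    then have len: "length (m # ys) = length (m # ys')"
      using distinct_card[OF c.distinct_cycle] distinct_card[OF c'.distinct_cycle] by simp
    have "m # ys = m # ys'"
    proof (rule nth_equalityI[OF len])
      fix i assume i: "i < length (m # ys)"
      \<comment> \<open>Entry \<open>i\<close> of either list is the \<open>i\<close>-th iterate of
        the common permutation at \<open>m\<close>.\<close>
      show "(m # ys) ! i = (m # ys') ! i"
        using c.funpow_nth[of 0 i] c'.funpow_nth[of 0 i] i len by simp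
    qed
    then have ys: "ys = ys'" by simp
    have "inj (cycle_of_list (m # ys))" using cycle_permutes permutes_inj by blast
    moreover have "cycle_of_list (m # ys) (q x) = cycle_of_list (m # ys) (q' x)" for x
      using fun_cong[OF eq, of x] by (simp only: A A' ys case_prod_conv comp_apply)
    ultimately have "q = q'" by (auto simp: inj_def)
    then show "a = a'" using A A' ys c.ys(1) c'.ys(1) by simp
  qed
  show "?f ` ?Q = ?P"
  proof (intro equalityI subsetI)
    fix p assume "p \<in> ?f ` ?Q"
    then obtain T ys q where "(T, ys, q) \<in> ?Q" and p: "p = cycle_of_list (m # ys) \<circ> q" by auto
    then have T: "T \<subseteq> S" "set ys = T" "q permutes S - T" by (auto simp: permutations_of_set_def)
    have "cycle_of_list (m # ys) permutes insert m S"
      using T by (intro permutes_subset[OF cycle_permutes]) auto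
    moreover have "q permutes insert m S" using T(3) by (rule permutes_subset) auto
    ultimately show "p \<in> ?P" unfolding p by (simp add: permutes_compose)
  next
    fix p assume "p \<in> ?P"
    then have p: "p permutes insert m S" by simp
    have fin: "finite (insert m S)" using assms by simp
    have perm: "permutation p" using p fin permutation_permutes by blast
    \<comment> \<open>\<open>support p m\<close> lists the orbit of \<open>m\<close> in the order of
      iteration, beginning with \<open>m\<close> itself.\<close>
    define c where "c = support p m"
    define ys where "ys = tl c"
    have "least_power p m > 0" by (rule least_power_of_permutation(2)[OF perm])
    then have c: "c = m # ys"
      unfolding ys_def c_def by (simp add: upt_conv_Cons)
    have "distinct c" unfolding c_def by (rule cycle_of_permutation[OF perm])
    have "set c \<subseteq> insert m S"
      unfolding c_def using permutes_in_image[OF permutes_funpow[OF p]] by auto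
    define q where "q = (\<lambda>y. if y \<in> insert m S - set c then p y else y)"
    have "q permutes insert m S - set c"
      unfolding q_def c_def by (rule semidecomposition[OF p fin])
    moreover have "insert m S - set c = S - set ys" using c assms(2) by auto
    ultimately have q: "q permutes S - set ys" by simp
    have "cycle_of_list c \<circ> q = p"
    proof
      fix x
      consider "x \<in> insert m S - set c" | "x \<in> set c" | "x \<notin> insert m S" "x \<notin> set c" by blast
      then show "(cycle_of_list c \<circ> q) x = p x"
      proof cases
        case 1
        then have "q x = p x" by (simp add: q_def)
        moreover have "q x \<in> insert m S - set c"
          using 1 permutes_in_image[OF \<open>q permutes insert m S - set c\<close>] by simp
        ultimately show ?thesis using id_outside_supp[of "p x" c] by simp
      next
        case 2
        then show ?thesis using cycle_restrict[OF perm, of x m] by (simp add: q_def c_def)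
      next
        case 3
        then show ?thesis using id_outside_supp[of x c] permutes_not_in[OF p, of x] by (simp add: q_def)
      qed
    qed
    then have "p = ?f (set ys, ys, q)" using c by simp
    moreover have "(set ys, ys, q) \<in> ?Q"
      using q \<open>distinct c\<close> \<open>set c \<subseteq> insert m S\<close> c by (auto simp: permutations_of_set_def)
    ultimately show "p \<in> ?f ` ?Q" by (rule image_eqI)
  qed
qed

section \<open>Generating polynomial of odd order permutations\<close>

definition odd_perm_gf :: "nat set \<Rightarrow> real poly" where
  "odd_perm_gf S = (\<Sum>p | p permutes S. if odd_on S p then monom 1 (M_on S p) else 0)"

lemma min_cycle_gf_sum:
  fixes T :: "nat set"
  assumes "finite T"
  shows "(\<Sum>ys\<in>permutations_of_set T. if even (card T) then monom 1 (cycle_min ys) else 0) =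
    min_cycle_gf (card T)"
proof (cases "T = {}")
  case True
  then show ?thesis by (simp add: min_cycle_gf_def cycle_min_def)
next
  case False
  then have "(\<Sum>ys\<in>permutations_of_set T. if even (card T) then monom 1 (cycle_min ys) else 0) =
      (\<Sum>ys\<in>permutations_of_set T. if even (card T) then
        monom 1 (min (Suc (descents (updown ys))) (Suc (ascents (updown ys)))) else (0 :: real poly))"
    by (intro sum.cong refl) (auto simp: permutations_of_set_def cycle_min_def)
  also have "\<dots> = word_sum (card T) (\<lambda>bs. if even (card T) then
        monom 1 (min (Suc (descents bs)) (Suc (ascents bs))) else 0)"
    by (rule word_sum_card[OF assms])
  also have "\<dots> = min_cycle_gf (card T)"
    using False assms by (simp add: min_cycle_gf_def word_sum_def)
  finally show ?thesis .
qed

text \<open>Opening the cycle of the maximum gives the recursion of \<open>exp_seq\<close>: that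
  cycle has length \<open>card T + 1\<close>, odd exactly for even \<open>card T\<close>, and
  \<open>M\<close> adds up over cycles, so the weights multiply.\<close>

theorem odd_perm_gf_eq_exp_seq:
  "finite S \<Longrightarrow> odd_perm_gf S = exp_seq min_cycle_gf (card S)"
proof (induction "card S" arbitrary: S rule: less_induct)
  case less
  show ?case
  proof (cases "S = {}")
    case True
    then show ?thesis by (simp add: odd_perm_gf_def odd_on_def M_on_def)
  next
    case False
    define m where "m = Max S"
    define S' where "S' = S - {m}"
    have "m \<in> S" unfolding m_def by (rule Max_in[OF less.prems False])
    then have S: "S = insert m S'" "m \<notin> S'" "finite S'"
      using less.prems by (auto simp: S'_def)
    have max: "x < m" if "x \<in> S'" for x
      using that Max_ge[OF less.prems, of x] by (simp add: S'_def m_def less_le)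
    have card: "card S = Suc (card S')" using S by simp
    let ?Q = "SIGMA T:Pow S'. permutations_of_set T \<times> {q. q permutes S' - T}"
    let ?g = "\<lambda>p. if odd_on S p then monom 1 (M_on S p) else 0 :: real poly"
    let ?u = "\<lambda>T ys. if even (card T) then monom 1 (cycle_min ys) else 0 :: real poly"
    let ?v = "\<lambda>T q. if odd_on (S' - T) q then monom 1 (M_on (S' - T) q) else 0 :: real poly"
    have "odd_perm_gf S = (\<Sum>a\<in>?Q. ?g ((\<lambda>(T, ys, q). cycle_of_list (m # ys) \<circ> q) a))"
      unfolding odd_perm_gf_def
      using sum.reindex_bij_betw[OF bij_betw_cycle_composition[OF S(3,2)], of ?g] S(1) by simp
    also have "\<dots> = (\<Sum>(T, ys, q)\<in>?Q. ?u T ys * ?v T q)"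
    proof (rule sum.cong[OF refl])
      fix a assume a: "a \<in> ?Q"
      obtain T ys q where A: "a = (T, ys, q)" by (cases a)
      interpret cycle_composition m S' T ys q "cycle_of_list (m # ys) \<circ> q"
        using a S(2) by (auto simp: A cycle_composition_def permutations_of_set_def)
      show "?g ((\<lambda>(T, ys, q). cycle_of_list (m # ys) \<circ> q) a) = (\<lambda>(T, ys, q). ?u T ys * ?v T q) a"
        using odd_on_insert M_on_insert[OF S(3) max] by (simp add: A S(1) mult_monom del: cycle_of_list.simps)
    qed
    also have "\<dots> = (\<Sum>T\<in>Pow S'. \<Sum>ys\<in>permutations_of_set T. \<Sum>q | q permutes S' - T. ?u T ys * ?v T q)"
      using S(3) by (simp add: sum.Sigma sum.cartesian_product finite_permutations finite_subset)
    also have "\<dots> = (\<Sum>T\<in>Pow S'. min_cycle_gf (card T) * exp_seq min_cycle_gf (card (S' - T)))"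
    proof (rule sum.cong[OF refl])
      fix T assume T: "T \<in> Pow S'"
      then have fin: "finite T" "finite (S' - T)" using S(3) by (auto intro: finite_subset)
      have "card (S' - T) < card S" using card S(3) by (metis Diff_subset card_mono less_Suc_eq_le)
      then have "odd_perm_gf (S' - T) = exp_seq min_cycle_gf (card (S' - T))"
        using less.hyps fin(2) by blast
      then show "(\<Sum>ys\<in>permutations_of_set T. \<Sum>q | q permutes S' - T. ?u T ys * ?v T q) =
          min_cycle_gf (card T) * exp_seq min_cycle_gf (card (S' - T))"
        unfolding min_cycle_gf_sum[OF fin(1), symmetric] odd_perm_gf_def[of "S' - T"]
        by (simp only: sum_product[symmetric])
    qed
    also have "\<dots> = exp_seq min_cycle_gf (card S)"
      unfolding card exp_seq_Suc by (rule sum_Pow_binconv[OF S(3)])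
    finally show ?thesis .
  qed
qed

section \<open>One-line notation\<close>

lemma bij_betw_one_line:
  "bij_betw (\<lambda>p. map p [1..<Suc n]) {p. p permutes {1..n}} (permutations_of_set {1..n})"
proof -
  let ?f = "\<lambda>p :: nat \<Rightarrow> nat. map p [1..<Suc n]"
  have set_upt: "set [1..<Suc n] = {1..n}" by auto
  have inj: "inj_on ?f {p. p permutes {1..n}}"
  proof (rule inj_onI)
    fix p q assume "p \<in> {p. p permutes {1..n}}" "q \<in> {p. p permutes {1..n}}" and eq: "?f p = ?f q"
    then have p: "p permutes {1..n}" and q: "q permutes {1..n}" by auto
    show "p = q"
    proof
      fix x show "p x = q x"
      proof (cases "x \<in> {1..n}")
        case True
        with eq show ?thesis unfolding map_eq_conv set_upt by blast
      next
        case False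
        then show ?thesis using permutes_not_in[OF p] permutes_not_in[OF q] by simp
      qed
    qed
  qed
  have sub: "?f ` {p. p permutes {1..n}} \<subseteq> permutations_of_set {1..n}"
  proof
    fix xs assume "xs \<in> ?f ` {p. p permutes {1..n}}"
    then obtain p where p: "p permutes {1..n}" and xs: "xs = ?f p" by blast
    have "set xs = {1..n}" unfolding xs set_map set_upt by (rule permutes_image[OF p])
    moreover have "distinct xs"
      unfolding xs distinct_map using permutes_inj_on[OF p] by simp
    ultimately show "xs \<in> permutations_of_set {1..n}" by (rule permutations_of_setI)
  qed
  \<comment> \<open>Both sets have n! elements, so injectivity already gives surjectivity.\<close>
  have "card (?f ` {p. p permutes {1..n}}) = card (permutations_of_set {1..n})"
    unfolding card_image[OF inj] by (simp add: card_permutations)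
  then have "?f ` {p. p permutes {1..n}} = permutations_of_set {1..n}"
    using sub by (intro card_subset_eq) simp_all
  with inj show ?thesis by (rule bij_betw_imageI)
qed

lemma asc_prefix_Suc: "i \<ge> 1 \<Longrightarrow> asc_prefix p (Suc i) = asc_prefix p i + (if p i < p (Suc i) then 1 else 0)"
proof -
  assume "i \<ge> 1"
  then have "{j. 1 \<le> j \<and> j < Suc i \<and> p j < p (Suc j)} =
      (if p i < p (Suc i) then insert i else id) {j. 1 \<le> j \<and> j < i \<and> p j < p (Suc j)}"
    by (auto simp: less_Suc_eq)
  then show ?thesis by (simp add: asc_prefix_def)
qed

lemma des_prefix_Suc: "i \<ge> 1 \<Longrightarrow> des_prefix p (Suc i) = des_prefix p i + (if p i > p (Suc i) then 1 else 0)"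
proof -
  assume "i \<ge> 1"
  then have "{j. 1 \<le> j \<and> j < Suc i \<and> p j > p (Suc j)} =
      (if p i > p (Suc i) then insert i else id) {j. 1 \<le> j \<and> j < i \<and> p j > p (Suc j)}"
    by (auto simp: less_Suc_eq)
  then show ?thesis by (simp add: des_prefix_def)
qed

text \<open>The first \<open>i\<close> letters of the word describe the gaps among the first
  \<open>i + 1\<close> entries, hence the shift to \<open>Suc i\<close>. Injectivity makes every gap
  that is not an ascent a descent.\<close>

lemma prefix_updown:
  assumes "inj p" "i < n"
  shows "ascents (take i (updown (map p [1..<Suc n]))) = asc_prefix p (Suc i) \<and>
         descents (take i (updown (map p [1..<Suc n]))) = des_prefix p (Suc i)"
  using assms(2)
proof (induction i)
  case 0
  show ?case by (simp add: asc_prefix_def des_prefix_def)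
next
  case (Suc i)
  let ?xs = "map p [1..<Suc n]"
  have nth: "updown ?xs ! i = (p (Suc i) < p (Suc (Suc i)))"
    using Suc.prems by (subst updown_nth) (simp_all del: upt_Suc)
  have "take (Suc i) (updown ?xs) = take i (updown ?xs) @ [updown ?xs ! i]"
    using Suc.prems by (intro take_Suc_conv_app_nth) (simp del: upt_Suc)
  moreover have "p (Suc i) \<noteq> p (Suc (Suc i))"
    using inj_eq[OF assms(1), of "Suc i" "Suc (Suc i)"] by simp
  ultimately show ?case
    using Suc unfolding nth by (auto simp: asc_prefix_Suc des_prefix_Suc simp del: upt_Suc)
qed

lemma ballot_iff_ballot_word:
  assumes "inj p" "n \<ge> 1"
  shows "ballot n p \<longleftrightarrow> ballot_word (updown (map p [1..<Suc n]))"
proof -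
  let ?bs = "updown (map p [1..<Suc n])"
  have "ballot_word ?bs \<longleftrightarrow> (\<forall>i<n. des_prefix p (Suc i) \<le> asc_prefix p (Suc i))"
    using assms(2) prefix_updown[OF assms(1)]
    by (auto simp: ballot_word_def ht_def Suc_le_eq[symmetric] le_diff_conv2 simp del: upt_Suc)
  also have "\<dots> \<longleftrightarrow> ballot n p"
    unfolding ballot_def by (metis Suc_le_eq Suc_le_mono Suc_pred' atLeastAtMost_iff le0 One_nat_def)
  finally show ?thesis by simp
qed

lemma des_eq_descents:
  assumes "inj p" "n \<ge> 1"
  shows "des n p = descents (updown (map p [1..<Suc n]))"
  using prefix_updown[OF assms(1), of "n - 1" n] assms(2) by (simp add: des_def del: upt_Suc)

lemma coeff_sum_monom:
  assumes "finite A"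
  shows "coeff (\<Sum>x\<in>A. if P x then monom 1 (f x) else (0 :: real poly)) d = real (card {x \<in> A. P x \<and> f x = d})"
proof -
  have "coeff (\<Sum>x\<in>A. if P x then monom 1 (f x) else (0 :: real poly)) d =
      (\<Sum>x\<in>A. if P x \<and> f x = d then 1 else 0)"
    unfolding coeff_sum by (intro sum.cong refl) simp
  also have "\<dots> = real (card {x \<in> A. P x \<and> f x = d})"
    using assms by (simp add: sum.If_cases Int_def)
  finally show ?thesis .
qed

theorem theorem1p2:
  fixes n d :: nat
  assumes "n \<ge> 1" and "d \<le> (n - 1) div 2"
  shows "card {p. p permutes {1..n} \<and> ballot n p \<and> des n p = d}
       = card {p. p permutes {1..n} \<and> odd_order n p \<and> M n p = d}"
proof -
  have fin: "finite {p. p permutes {1..n}}" by (simp add: finite_permutations)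
  let ?w = "\<lambda>p. updown (map p [1..<Suc n])"
  \<comment> \<open>\<open>word_sum\<close> uses the letters \<open>{..<n}\<close>;
    \<open>word_sum_card\<close> relabels them to \<open>{1..n}\<close>.\<close>
  have "ballot_gf n = (\<Sum>xs\<in>permutations_of_set {1..n}.
      if ballot_word (updown xs) then monom 1 (descents (updown xs)) else 0)"
    using word_sum_card[of "{1..n}" "\<lambda>bs. if ballot_word bs then monom 1 (descents bs) else (0 :: real poly)"]
    by (simp add: ballot_gf_def)
  also have "\<dots> = (\<Sum>p | p permutes {1..n}. if ballot_word (?w p) then monom 1 (descents (?w p)) else 0)"
    by (rule sum.reindex_bij_betw[OF bij_betw_one_line, symmetric])
  also have "\<dots> = (\<Sum>p | p permutes {1..n}. if ballot n p then monom 1 (des n p) else 0)"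
  proof (rule sum.cong[OF refl])
    fix p assume "p \<in> {p. p permutes {1..n}}"
    then have "inj p" using permutes_inj by blast
    then show "(if ballot_word (?w p) then monom 1 (descents (?w p)) else 0) =
        (if ballot n p then monom 1 (des n p) else (0 :: real poly))"
      by (simp only: ballot_iff_ballot_word[OF _ assms(1)] des_eq_descents[OF _ assms(1)])
  qed
  finally have gf: "ballot_gf n = (\<Sum>p | p permutes {1..n}. if ballot n p then monom 1 (des n p) else 0)" .
  \<comment> \<open>Each count is the coefficient of t^d in a generating polynomial, and both
    polynomials equal \<open>exp_seq min_cycle_gf n\<close>.\<close>
  have "coeff (ballot_gf n) d = real (card {p. p permutes {1..n} \<and> ballot n p \<and> des n p = d})"
    unfolding gf coeff_sum_monom[OF fin] by simp
  moreover have "coeff (odd_perm_gf {1..n}) d = real (card {p. p permutes {1..n} \<and> odd_order n p \<and> M n p = d})"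
    unfolding odd_perm_gf_def coeff_sum_monom[OF fin]
    by (simp add: odd_on_def M_on_def odd_order_def M_def cycles_def)
  moreover have "ballot_gf n = odd_perm_gf {1..n}"
    by (simp add: ballot_gf_eq_exp_seq odd_perm_gf_eq_exp_seq)
  ultimately show ?thesis by simp
qed

end
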